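(* There is a randomized algorithm which takes as input parameters $k \in \mathbb{N}$ and $\epsilon>0$ and has query (oracle) access to an arbitrary function $f:\{-1,1\}^n \rightarrow \{-1,1\}$, makes $2^k \cdot \mathrm{poly}(k,1/\epsilon)$ queries to $f$, and with probability at least $2/3$ outputs a number $\widehat{\mathsf{Corr}}_{f,k}$ together with a function $h:\{-1,1\}^k \rightarrow \{-1,1\}$ such that \[ \Big| \widehat{\mathsf{Corr}}_{f,k} - \max_{\ell \in \mathcal{J}_{n,k}} \mathbf{E}_{\mathbf{x}}[\ell(\mathbf{x}) f(\mathbf{x})] \Big| \le \epsilon, \] and there is a set of coordinates $\mathcal{T}=\{i_1,\ldots,i_k\}\subseteq[n]$ with \[ \Big| \max_{\ell \in \mathcal{J}_{n,k}} \mathbf{E}_{\mathbf{x}}[\ell(\mathbf{x}) f(\mathbf{x})] - \mathbf{E}_{\mathbf{x}}[h(\mathbf{x}_{i_1},\ldots,\mathbf{x}_{i_k}) f(\mathbf{x})]\Big| \le \epsilon. \]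
   Context: A function $g:\{-1,1\}^n\to\{-1,1\}$ is a $k$-junta if there are $k$ coordinates $i_1,\dots,i_k\in[n]$ such that $g(x)$ depends only on $x_{i_1},\dots,x_{i_k}$. $\mathcal{J}_{n,k}$ denotes the class of $k$-juntas on $n$ variables. All expectations are over $\mathbf{x}$ uniform on $\{-1,1\}^n$. The query complexity is the number of points at which the algorithm evaluates $f$; it must not depend on $n$. *)

theory Defs
  imports "HOL-Probability.Probability" "HOL-Computational_Algebra.Polynomial"
begin

text \<open>The coordinate set $[n]$ is \<open>{..<n}\<close>; points and functions are extensional, so that
  \<open>cube n\<close>, \<open>bool_funs n\<close> and \<open>juntas n k\<close> are finite sets.\<close>

definition cube :: "nat \<Rightarrow> (nat \<Rightarrow> real) set" where
  "cube n = {..<n} \<rightarrow>\<^sub>E {-1, 1}"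

definition bool_funs :: "nat \<Rightarrow> ((nat \<Rightarrow> real) \<Rightarrow> real) set" where
  "bool_funs n = cube n \<rightarrow>\<^sub>E {-1, 1}"

definition coords :: "nat \<Rightarrow> nat \<Rightarrow> (nat \<Rightarrow> nat) set" where
  "coords n k = {i. i \<in> {..<k} \<rightarrow> {..<n} \<and> inj_on i {..<k}}"

text \<open>The point \<open>(x\<^bsub>i 0\<^esub>, \<dots>, x\<^bsub>i (k-1)\<^esub>)\<close> of \<open>cube k\<close>.\<close>
definition proj :: "nat \<Rightarrow> (nat \<Rightarrow> nat) \<Rightarrow> (nat \<Rightarrow> real) \<Rightarrow> (nat \<Rightarrow> real)" where
  "proj k i x = (\<lambda>j\<in>{..<k}. x (i j))"

definition juntas :: "nat \<Rightarrow> nat \<Rightarrow> ((nat \<Rightarrow> real) \<Rightarrow> real) set" where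
  "juntas n k = {g \<in> bool_funs n. \<exists>i\<in>coords n k.
     \<forall>x\<in>cube n. \<forall>y\<in>cube n. (\<forall>j<k. x (i j) = y (i j)) \<longrightarrow> g x = g y}"

definition corr :: "nat \<Rightarrow> ((nat \<Rightarrow> real) \<Rightarrow> real) \<Rightarrow> ((nat \<Rightarrow> real) \<Rightarrow> real) \<Rightarrow> real" where
  "corr n g f = measure_pmf.expectation (pmf_of_set (cube n)) (\<lambda>x. g x * f x)"

definition max_corr :: "nat \<Rightarrow> nat \<Rightarrow> ((nat \<Rightarrow> real) \<Rightarrow> real) \<Rightarrow> real" where
  "max_corr n k f = Max ((\<lambda>l. corr n l f) ` juntas n k)"

text \<open>Deterministic adaptive query algorithms (decision trees): \<open>Query x s t\<close> evaluates the oracle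
  at \<open>x\<close> and continues with \<open>s\<close> if the answer is \<open>-1\<close> and with \<open>t\<close> if it is \<open>1\<close>.
  A randomized query algorithm is a probability distribution on decision trees.\<close>

datatype (query_points: 'q, outputs: 'r) decision_tree =
    Output 'r
  | Query 'q "('q, 'r) decision_tree" "('q, 'r) decision_tree"

primrec run :: "('q \<Rightarrow> real) \<Rightarrow> ('q, 'r) decision_tree \<Rightarrow> 'r" where
  "run f (Output r) = r"
| "run f (Query x s t) = (if f x = 1 then run f t else run f s)"

primrec num_queries :: "('q \<Rightarrow> real) \<Rightarrow> ('q, 'r) decision_tree \<Rightarrow> nat" where
  "num_queries f (Output r) = 0"
| "num_queries f (Query x s t) = Suc (if f x = 1 then num_queries f t else num_queries f s)"

definition poly2 :: "'a::comm_semiring_1 poly poly \<Rightarrow> 'a \<Rightarrow> 'a \<Rightarrow> 'a" where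
  "poly2 p x y = poly (poly p [:y:]) x"

lemma finite_cube: "finite (cube n)"
  by (simp add: cube_def finite_PiE)

lemma cube_nonempty: "cube n \<noteq> {}"
  by (simp add: cube_def PiE_eq_empty_iff)

lemma finite_juntas: "finite (juntas n k)"
proof (rule finite_subset)
  show "juntas n k \<subseteq> bool_funs n" by (auto simp: juntas_def)
  show "finite (bool_funs n)" by (simp add: bool_funs_def finite_cube finite_PiE)
qed

lemma juntas_nonempty:
  assumes "k \<le> n"
  shows "juntas n k \<noteq> {}"
proof -
  have "(\<lambda>x\<in>cube n. 1) \<in> juntas n k"
    using assms by (auto simp: juntas_def bool_funs_def coords_def intro!: exI[of _ id])
  then show ?thesis by blast
qed

end

theory Submission
  imports Defs
begin

text \<open>Hash the coordinates into \<open>m = poly(k, 1/\<epsilon>)\<close> buckets by a random \<open>b\<close> and query \<open>f\<close> only at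
  points \<open>x i = z i * y (b i)\<close>, where \<open>z\<close> is a fixed random shift, \<open>y\<close> a fresh uniform point of
  \<open>cube m\<close>, and \<open>x\<close> is perturbed by a little noise. The noise changes the correlation with
  \<open>k\<close>-juntas by at most \<open>k / q\<close> but bounds the total influence of \<open>f\<close> by \<open>q\<close>. Hence the few
  coordinates of large influence fall into different buckets, and in mean square over \<open>z\<close> the
  remaining Fourier mass aliased onto them is negligible, so that correlations with juntas on
  influential coordinates are preserved.

  Splitting every bucket by the sign of \<open>z\<close> and measuring the influence of flipping a half bucket
  shows which halves contain an influential coordinate \<open>i\<close>; for these the sign \<open>z i\<close> is known, so
  that the value \<open>x i = z i * y (b i)\<close> is available although \<open>i\<close> is not. It remains to maximise the
  empirical correlation over the at most \<open>(2 * m + 1) ^ k * 2 ^ 2 ^ k\<close> juntas on such coordinates,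
  for which \<open>2 ^ k * poly(k, 1/\<epsilon>)\<close> samples suffice by Hoeffding's inequality and a union bound.\<close>

section \<open>Fourier analysis on the cube\<close>

text \<open>Hashing causes aliasing: characters that meet every bucket with the same parity differ
  only by a sign at the queried points. For a fixed shift such coefficients can add up coherently;
  over a random \<open>z\<close> the signs are orthogonal, so that only squares remain, and these
  are controlled by influences. Without noise the weight of \<open>f\<close> may sit on sets of more
  than \<open>m\<close> elements, on which every hash collides; the bound
  \<open>u * \<rho> ^ u \<le> q\<close> is what makes all estimates free of \<open>n\<close>.

  The parameters hang on the influence threshold \<tau>. Dropping coordinates of influence at most 3
  * \<tau> may cost (k + 1) / q in correlation, hence \<tau> = 1 / (12 * q^2). Markov's inequality
  for the collision quantities at level \<tau>^2 / 2 then gives m = 6912 * q^6. Hash, shift and the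
  two batches of samples fail with probability at most 1 / 12 each, 1 / 3 in total.

  Acceptance of half buckets is necessarily fuzzy: coordinates of influence between \<tau> and 3 *
  \<tau> may be found or missed. Both are harmless, since found ones are still separated by the hash
  and missed ones are cheap to drop.\<close>

definition avg :: "'a set \<Rightarrow> ('a \<Rightarrow> real) \<Rightarrow> real" where
  "avg A F = (\<Sum>a\<in>A. F a) / card A"

lemma avg_cong: "(\<And>a. a \<in> A \<Longrightarrow> F a = G a) \<Longrightarrow> avg A F = avg A G"
  by (simp add: avg_def cong: sum.cong)

lemma avg_mono: "(\<And>a. a \<in> A \<Longrightarrow> F a \<le> G a) \<Longrightarrow> avg A F \<le> avg A G"
  by (simp add: avg_def divide_right_mono sum_mono)

lemma avg_const: "finite A \<Longrightarrow> A \<noteq> {} \<Longrightarrow> avg A (\<lambda>_. c) = c"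
  by (simp add: avg_def)

lemma avg_sum: "avg A (\<lambda>a. \<Sum>i\<in>I. F i a) = (\<Sum>i\<in>I. avg A (F i))"
proof -
  have "(\<Sum>a\<in>A. \<Sum>i\<in>I. F i a) = (\<Sum>i\<in>I. \<Sum>a\<in>A. F i a)"
    by (rule sum.swap)
  then show ?thesis by (simp add: avg_def sum_divide_distrib)
qed

lemma avg_add: "avg A (\<lambda>a. F a + G a) = avg A F + avg A G"
  by (simp add: avg_def sum.distrib add_divide_distrib)

lemma avg_diff: "avg A (\<lambda>a. F a - G a) = avg A F - avg A G"
  by (simp add: avg_def sum_subtractf diff_divide_distrib)

lemma avg_mult_left: "avg A (\<lambda>a. c * F a) = c * avg A F"
  by (simp add: avg_def flip: sum_distrib_left)

lemma avg_mult_right: "avg A (\<lambda>a. F a * c) = avg A F * c"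
  by (simp add: avg_def flip: sum_distrib_right)

lemma avg_divide: "avg A (\<lambda>a. F a / c) = avg A F / c"
  by (simp add: avg_def flip: sum_divide_distrib)

lemma avg_Times: "avg (A \<times> B) F = avg A (\<lambda>a. avg B (\<lambda>b. F (a, b)))"
  by (simp add: avg_def sum.cartesian_product card_cartesian_product flip: sum_divide_distrib)

lemma avg_swap: "avg A (\<lambda>a. avg B (F a)) = avg B (\<lambda>b. avg A (\<lambda>a. F a b))"
proof -
  have "(\<Sum>a\<in>A. \<Sum>b\<in>B. F a b) = (\<Sum>b\<in>B. \<Sum>a\<in>A. F a b)" by (rule sum.swap)
  then show ?thesis by (simp add: avg_def mult.commute flip: sum_divide_distrib)
qed

lemma exists_ge_avg:
  assumes "finite A" "A \<noteq> {}"
  shows "\<exists>a\<in>A. avg A F \<le> F a"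
proof (rule ccontr)
  assume "\<not> ?thesis"
  then have "(\<Sum>a\<in>A. F a) < (\<Sum>a\<in>A. avg A F)"
    using assms by (intro sum_strict_mono) auto
  then show False using assms by (simp add: avg_def)
qed

lemma expectation_uniform:
  "finite A \<Longrightarrow> A \<noteq> {} \<Longrightarrow> measure_pmf.expectation (pmf_of_set A) F = avg A F"
  by (simp add: avg_def integral_pmf_of_set)

lemma markov_uniform:
  assumes "finite A" "A \<noteq> {}" "\<And>a. a \<in> A \<Longrightarrow> 0 \<le> F a" "0 < c"
  shows "measure_pmf.prob (pmf_of_set A) {a. c < F a} \<le> avg A F / c"
proof -
  have "c * card (A \<inter> {a. c < F a}) = (\<Sum>a\<in>A \<inter> {a. c < F a}. c)" by simp
  also have "\<dots> \<le> (\<Sum>a\<in>A \<inter> {a. c < F a}. F a)" by (intro sum_mono) auto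
  also have "\<dots> \<le> (\<Sum>a\<in>A. F a)" using assms by (intro sum_mono2) auto
  finally have "real (card (A \<inter> {a. c < F a})) \<le> (\<Sum>a\<in>A. F a) / c"
    using assms(4) by (simp add: field_simps)
  then have "real (card (A \<inter> {a. c < F a})) / card A \<le> (\<Sum>a\<in>A. F a) / c / card A"
    by (rule divide_right_mono) simp
  then show ?thesis using assms by (simp add: measure_pmf_of_set avg_def mult.commute)
qed

text \<open>Independence of the coordinates, used alike for cube points, noise vectors and hash
  functions; a coordinate outside \<open>U\<close> contributes the factor 1.\<close>

lemma avg_PiE_prod:
  assumes "finite I" "U \<subseteq> I" "finite C" "C \<noteq> {}"
  shows "avg (I \<rightarrow>\<^sub>E C) (\<lambda>x. \<Prod>i\<in>U. g i (x i)) = (\<Prod>i\<in>U. avg C (g i))"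
proof -
  let ?h = "\<lambda>i c. if i \<in> U then g i c else 1"
  have "(\<Sum>x\<in>I \<rightarrow>\<^sub>E C. \<Prod>i\<in>U. g i (x i)) = (\<Sum>x\<in>I \<rightarrow>\<^sub>E C. \<Prod>i\<in>I. ?h i (x i))"
    using assms by (intro sum.cong prod.mono_neutral_cong_left) auto
  also have "\<dots> = (\<Prod>i\<in>I. \<Sum>c\<in>C. ?h i c)"
    using assms by (subst prod_sum_PiE) auto
  finally have "avg (I \<rightarrow>\<^sub>E C) (\<lambda>x. \<Prod>i\<in>U. g i (x i)) = (\<Prod>i\<in>I. \<Sum>c\<in>C. ?h i c) / (\<Prod>i\<in>I. real (card C))"
    using assms by (simp add: avg_def card_PiE)
  also have "\<dots> = (\<Prod>i\<in>I. avg C (?h i))" by (simp add: avg_def prod_dividef)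
  also have "\<dots> = (\<Prod>i\<in>U. avg C (g i))"
    using assms by (intro prod.mono_neutral_cong_right) (auto simp: avg_const)
  finally show ?thesis .
qed

section \<open>Characters and Fourier coefficients\<close>

definition chi :: "nat set \<Rightarrow> (nat \<Rightarrow> real) \<Rightarrow> real" where
  "chi U x = (\<Prod>i\<in>U. x i)"

definition fourier :: "nat \<Rightarrow> ((nat \<Rightarrow> real) \<Rightarrow> real) \<Rightarrow> nat set \<Rightarrow> real" where
  "fourier n f U = avg (cube n) (\<lambda>x. f x * chi U x)"

lemma cube_values: "x \<in> cube n \<Longrightarrow> i < n \<Longrightarrow> x i = 1 \<or> x i = -1"
  by (auto simp: cube_def PiE_iff)

lemma cube_square: "x \<in> cube n \<Longrightarrow> i < n \<Longrightarrow> x i * x i = 1"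
  using cube_values by fastforce

lemma card_cube: "card (cube n) = 2 ^ n"
  by (simp add: cube_def card_PiE numeral_2_eq_2)

lemma chi_square:
  assumes "x \<in> cube n" "U \<subseteq> {..<n}"
  shows "chi U x * chi U x = 1"
  using assms cube_square[of x n] by (auto simp: chi_def subset_iff simp flip: prod.distrib intro!: prod.neutral)

lemma avg_chi:
  assumes "U \<subseteq> {..<n}"
  shows "avg (cube n) (chi U) = (if U = {} then 1 else 0)"
proof -
  have "finite U" using assms finite_subset by blast
  have "avg (cube n) (\<lambda>x. \<Prod>i\<in>U. x i) = (\<Prod>i\<in>U. avg {-1,1} (\<lambda>c. c))"
    unfolding cube_def using assms by (intro avg_PiE_prod) auto
  then show ?thesis using \<open>finite U\<close> unfolding chi_def by (simp add: avg_def card_gt_0_iff)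
qed

text \<open>The factors over the common elements occur squared and cancel.\<close>

lemma chi_mult_chi:
  assumes "x \<in> cube n" "U \<subseteq> {..<n}" "V \<subseteq> {..<n}"
  shows "chi U x * chi V x = chi ((U - V) \<union> (V - U)) x"
proof -
  have fin: "finite U" "finite V" using assms finite_subset by blast+
  have "chi U x = chi (U - V) x * chi (U \<inter> V) x"
    unfolding chi_def using fin by (metis Int_commute mult.commute prod.Int_Diff)
  moreover have "chi V x = chi (V - U) x * chi (U \<inter> V) x"
    unfolding chi_def using fin by (metis Int_commute mult.commute prod.Int_Diff)
  moreover have "chi (U \<inter> V) x * chi (U \<inter> V) x = 1"
    using assms by (intro chi_square) auto
  moreover have "chi ((U - V) \<union> (V - U)) x = chi (U - V) x * chi (V - U) x"
    unfolding chi_def using fin by (intro prod.union_disjoint) auto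
  ultimately show ?thesis by (simp add: algebra_simps)
qed

lemma avg_chi_chi:
  assumes "U \<subseteq> {..<n}" "V \<subseteq> {..<n}"
  shows "avg (cube n) (\<lambda>x. chi U x * chi V x) = (if U = V then 1 else 0)"
proof -
  have "avg (cube n) (\<lambda>x. chi U x * chi V x) = avg (cube n) (chi ((U - V) \<union> (V - U)))"
    using assms by (intro avg_cong chi_mult_chi)
  also have "\<dots> = (if (U - V) \<union> (V - U) = {} then 1 else 0)"
    using assms by (intro avg_chi) auto
  finally show ?thesis by auto
qed

text \<open>Parseval in terms of coefficients over an arbitrary family of sets, so that it also
  applies to alias errors, which are polynomials in the shift.\<close>

lemma avg_polynomials:
  assumes "\<A> \<subseteq> Pow {..<n}"
  shows "avg (cube n) (\<lambda>x. (\<Sum>U\<in>\<A>. a U * chi U x) * (\<Sum>U\<in>\<A>. c U * chi U x)) = (\<Sum>U\<in>\<A>. a U * c U)"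
proof -
  have fin: "finite \<A>" using assms finite_subset by auto
  have "avg (cube n) (\<lambda>x. (\<Sum>U\<in>\<A>. a U * chi U x) * (\<Sum>U\<in>\<A>. c U * chi U x))
      = avg (cube n) (\<lambda>x. \<Sum>U\<in>\<A>. \<Sum>V\<in>\<A>. (a U * c V) * (chi U x * chi V x))"
    by (simp add: sum_product algebra_simps)
  also have "\<dots> = (\<Sum>U\<in>\<A>. \<Sum>V\<in>\<A>. (a U * c V) * avg (cube n) (\<lambda>x. chi U x * chi V x))"
    by (simp add: avg_sum avg_mult_left)
  also have "\<dots> = (\<Sum>U\<in>\<A>. \<Sum>V\<in>\<A>. if U = V then a U * c V else 0)"
    using assms by (intro sum.cong refl) (subst avg_chi_chi, auto)
  also have "\<dots> = (\<Sum>U\<in>\<A>. a U * c U)" using fin by simp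
  finally show ?thesis .
qed

text \<open>The kernel factorises over the coordinates into \<open>y i * x i + 1\<close>, which is 2
  where the points agree and 0 where they differ.\<close>

lemma fourier_expansion:
  assumes "x \<in> cube n"
  shows "f x = (\<Sum>U\<in>Pow {..<n}. fourier n f U * chi U x)"
proof -
  have kernel: "(\<Sum>U\<in>Pow {..<n}. chi U y * chi U x) = (if y = x then 2 ^ n else 0)" if y: "y \<in> cube n" for y
  proof -
    have "(\<Sum>U\<in>Pow {..<n}. chi U y * chi U x) = (\<Prod>i<n. y i * x i + 1)"
      by (simp add: prod_add chi_def prod.distrib)
    also have "\<dots> = (if y = x then 2 ^ n else 0)"
    proof (cases "y = x")
      case True
      then show ?thesis using cube_square[OF y] by simp
    next
      case False
      then obtain i where i: "i < n" "y i \<noteq> x i"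
        using assms y unfolding cube_def by (metis PiE_ext lessThan_iff)
      then have "y i * x i + 1 = 0"
        using cube_values[OF y i(1)] cube_values[OF assms i(1)] by auto
      then show ?thesis using i False by auto
    qed
    finally show ?thesis .
  qed
  have "(\<Sum>U\<in>Pow {..<n}. fourier n f U * chi U x)
      = avg (cube n) (\<lambda>y. f y * (\<Sum>U\<in>Pow {..<n}. chi U y * chi U x))"
    by (simp add: fourier_def avg_sum sum_distrib_left mult.assoc flip: avg_mult_right)
  also have "\<dots> = avg (cube n) (\<lambda>y. if y = x then f x * 2 ^ n else 0)"
    by (intro avg_cong) (simp add: kernel)
  also have "\<dots> = f x"
    using assms by (simp add: avg_def finite_cube card_cube)
  finally show ?thesis by simp
qed

lemma plancherel:
  "avg (cube n) (\<lambda>x. g x * f x) = (\<Sum>U\<in>Pow {..<n}. fourier n g U * fourier n f U)"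
proof -
  have "avg (cube n) (\<lambda>x. g x * f x) = avg (cube n) (\<lambda>x. \<Sum>U\<in>Pow {..<n}. (g x * chi U x) * fourier n f U)"
    by (intro avg_cong, subst fourier_expansion[of _ n f]) (simp_all add: sum_distrib_left mult_ac)
  then show ?thesis by (simp add: avg_sum avg_mult_right fourier_def)
qed

lemma parseval_bool:
  assumes "\<And>x. x \<in> cube n \<Longrightarrow> f x = 1 \<or> f x = -1"
  shows "(\<Sum>U\<in>Pow {..<n}. (fourier n f U)\<^sup>2) = 1"
proof -
  have "(\<Sum>U\<in>Pow {..<n}. (fourier n f U)\<^sup>2) = avg (cube n) (\<lambda>x. f x * f x)"
    by (simp add: plancherel power2_eq_square)
  also have "\<dots> = avg (cube n) (\<lambda>_. 1)"
    using assms by (intro avg_cong) fastforce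
  finally show ?thesis by (simp add: avg_const finite_cube cube_nonempty)
qed

section \<open>Functions of few coordinates\<close>

definition depends_only :: "nat \<Rightarrow> nat set \<Rightarrow> ((nat \<Rightarrow> real) \<Rightarrow> real) \<Rightarrow> bool" where
  "depends_only n W g \<longleftrightarrow> (\<forall>x\<in>cube n. \<forall>y\<in>cube n. (\<forall>i\<in>W. x i = y i) \<longrightarrow> g x = g y)"

text \<open>Negating a coordinate in \<open>U\<close> but outside \<open>W\<close> permutes the
  cube, preserves \<open>g\<close> and negates \<open>chi U\<close>; the coefficient equals its own
  negative.\<close>

lemma fourier_depends_only:
  assumes "depends_only n W g" "U \<subseteq> {..<n}" "\<not> U \<subseteq> W"
  shows "fourier n g U = 0"
proof -
  obtain i where i: "i \<in> U" "i \<notin> W" "i < n" using assms by auto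
  define T where "T = (\<lambda>x::nat\<Rightarrow>real. x(i := - x i))"
  have T: "T x \<in> cube n" if "x \<in> cube n" for x
    using that i cube_values[OF that] by (auto simp: T_def cube_def PiE_iff extensional_def)
  have TT: "T (T x) = x" for x by (auto simp: T_def)
  have fin: "finite U" using assms finite_subset by blast
  have "chi U (T x) = - chi U x" for x
  proof -
    have "(\<Prod>j\<in>U - {i}. T x j) = (\<Prod>j\<in>U - {i}. x j)" by (intro prod.cong) (auto simp: T_def)
    then show ?thesis
      unfolding chi_def using fin i by (simp add: prod.remove[of U i] T_def)
  qed
  moreover have "g (T x) = g x" if "x \<in> cube n" for x
  proof -
    have "\<forall>j\<in>W. T x j = x j" using i by (auto simp: T_def)
    then show ?thesis using assms(1) T[OF that] that unfolding depends_only_def by blast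
  qed
  moreover have "(\<Sum>x\<in>cube n. g x * chi U x) = (\<Sum>x\<in>cube n. g (T x) * chi U (T x))"
    by (rule sum.reindex_bij_witness[of _ T T]) (auto simp: T TT)
  ultimately have "(\<Sum>x\<in>cube n. g x * chi U x) = - (\<Sum>x\<in>cube n. g x * chi U x)"
    by (simp add: sum_negf)
  then show ?thesis by (simp add: fourier_def avg_def)
qed

lemma plancherel_depends_only:
  assumes "depends_only n W g" "W \<subseteq> {..<n}"
  shows "avg (cube n) (\<lambda>x. g x * f x) = (\<Sum>U\<in>Pow W. fourier n g U * fourier n f U)"
  unfolding plancherel using assms fourier_depends_only[OF assms(1)]
  by (intro sum.mono_neutral_right) auto

lemma expansion_depends_only:
  assumes "depends_only n W g" "W \<subseteq> {..<n}" "x \<in> cube n"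
  shows "g x = (\<Sum>U\<in>Pow W. fourier n g U * chi U x)"
  unfolding fourier_expansion[OF assms(3), of g] using assms fourier_depends_only[OF assms(1)]
  by (intro sum.mono_neutral_right) auto

lemma corr_avg: "corr n g f = avg (cube n) (\<lambda>x. g x * f x)"
  by (simp add: corr_def expectation_uniform finite_cube cube_nonempty)

section \<open>Sampling and decision trees\<close>

text \<open>The range [-1, 1] has length 2, which turns the usual exponent 2 * N * t^2 / length^2
  into N * t^2 / 2.\<close>

lemma hoeffding_uniform:
  fixes \<phi> :: "'a \<Rightarrow> real"
  assumes \<Omega>: "finite \<Omega>" "\<Omega> \<noteq> {}" and N: "0 < N" and t: "0 \<le> t"
    and bound: "\<And>a. a \<in> \<Omega> \<Longrightarrow> \<bar>\<phi> a\<bar> \<le> 1"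
  shows "measure_pmf.prob (Pi_pmf {..<N} d (\<lambda>_. pmf_of_set \<Omega>))
           {\<omega>. t \<le> \<bar>(\<Sum>l<N. \<phi> (\<omega> l)) / N - avg \<Omega> \<phi>\<bar>} \<le> 2 * exp (- (real N * t\<^sup>2 / 2))"
proof -
  let ?P = "Pi_pmf {..<N} d (\<lambda>_. pmf_of_set \<Omega>)"
  have comp: "map_pmf (\<lambda>\<omega>. \<omega> l) ?P = pmf_of_set \<Omega>" if "l < N" for l
    using that by (simp add: Pi_pmf_component)
  have exp: "measure_pmf.expectation ?P (\<lambda>\<omega>. \<phi> (\<omega> l)) = avg \<Omega> \<phi>" if "l < N" for l
  proof -
    have "measure_pmf.expectation ?P (\<lambda>\<omega>. \<phi> (\<omega> l)) = measure_pmf.expectation (map_pmf (\<lambda>\<omega>. \<omega> l) ?P) \<phi>"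
      by simp
    then show ?thesis using that \<Omega> by (simp add: comp expectation_uniform)
  qed
  have distr: "distr ?P borel (\<lambda>\<omega>. \<phi> (\<omega> l)) = distr (pmf_of_set \<Omega>) borel \<phi>" if "l < N" for l
  proof -
    have "distr ?P borel (\<lambda>\<omega>. \<phi> (\<omega> l)) = distr (distr ?P (count_space UNIV) (\<lambda>\<omega>. \<omega> l)) borel \<phi>"
      by (subst distr_distr) (auto simp: o_def)
    also have "distr ?P (count_space UNIV) (\<lambda>\<omega>. \<omega> l) = measure_pmf (map_pmf (\<lambda>\<omega>. \<omega> l) ?P)"
      by (simp add: map_pmf_rep_eq)
    finally show ?thesis using that by (simp add: comp)
  qed
  interpret H: Hoeffding_ineq_iid "measure_pmf ?P" "{..<N}" "\<lambda>l \<omega>. \<phi> (\<omega> l)" "\<lambda>\<omega>. \<phi> (\<omega> 0)" "-1" 1 "avg \<Omega> \<phi>"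
  proof unfold_locales
    show "prob_space.indep_vars (measure_pmf ?P) (\<lambda>_. borel) (\<lambda>l \<omega>. \<phi> (\<omega> l)) {..<N}"
      by (intro prob_space.indep_vars_compose2[OF _ indep_vars_Pi_pmf])
         (auto simp: measure_pmf.prob_space_axioms)
    show "avg \<Omega> \<phi> \<equiv> measure_pmf.expectation ?P (\<lambda>\<omega>. \<phi> (\<omega> 0))"
      using exp[of 0] N by simp
    show "AE \<omega> in measure_pmf ?P. \<phi> (\<omega> 0) \<in> {-1..1}"
      using \<Omega> N bound by (auto simp: AE_measure_pmf_iff set_Pi_pmf PiE_dflt_def abs_le_iff)
  qed (use N distr in auto)
  from H.Hoeffding_ineq_abs_ge'[OF t] N show ?thesis by (simp add: power2_eq_square lessThan_empty_iff mult_ac)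
qed

text \<open>The same samples serve all members of \<open>K\<close>. Sample sizes thus grow with the
  logarithm of \<open>card K\<close>, which is how 2 ^ 2 ^ k hypotheses cost only about 2 ^ k
  queries.\<close>

lemma uniform_convergence:
  fixes \<phi> :: "'b \<Rightarrow> 'a \<Rightarrow> real"
  assumes \<Omega>: "finite \<Omega>" "\<Omega> \<noteq> {}" and N: "0 < N" and t: "0 \<le> t" and K: "finite K"
    and bound: "\<And>c a. c \<in> K \<Longrightarrow> a \<in> \<Omega> \<Longrightarrow> \<bar>\<phi> c a\<bar> \<le> 1"
  shows "measure_pmf.prob (Pi_pmf {..<N} d (\<lambda>_. pmf_of_set \<Omega>))
           {\<omega>. \<exists>c\<in>K. t \<le> \<bar>(\<Sum>l<N. \<phi> c (\<omega> l)) / N - avg \<Omega> (\<phi> c)\<bar>}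
         \<le> card K * (2 * exp (- (real N * t\<^sup>2 / 2)))"
proof -
  let ?P = "Pi_pmf {..<N} d (\<lambda>_. pmf_of_set \<Omega>)"
  let ?B = "\<lambda>c. {\<omega>. t \<le> \<bar>(\<Sum>l<N. \<phi> c (\<omega> l)) / N - avg \<Omega> (\<phi> c)\<bar>}"
  have "measure_pmf.prob ?P {\<omega>. \<exists>c\<in>K. t \<le> \<bar>(\<Sum>l<N. \<phi> c (\<omega> l)) / N - avg \<Omega> (\<phi> c)\<bar>}
      = measure_pmf.prob ?P (\<Union>c\<in>K. ?B c)"
    by (rule arg_cong[where f = "measure_pmf.prob ?P"]) auto
  also have "\<dots> \<le> (\<Sum>c\<in>K. measure_pmf.prob ?P (?B c))"
    using K by (intro measure_pmf.finite_measure_subadditive_finite) auto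
  also have "\<dots> \<le> (\<Sum>c\<in>K. 2 * exp (- (real N * t\<^sup>2 / 2)))"
    using assms by (intro sum_mono hoeffding_uniform) auto
  finally show ?thesis by simp
qed

text \<open>A union bound along successive random choices: later stages need to be analysed only
  after good outcomes of the earlier ones.\<close>

lemma prob_bind_le:
  assumes "measure_pmf.prob p B \<le> \<alpha>"
    and "\<And>x. x \<in> set_pmf p \<Longrightarrow> x \<notin> B \<Longrightarrow> measure_pmf.prob (g x) E \<le> \<beta>" and "0 \<le> \<beta>"
  shows "measure_pmf.prob (bind_pmf p g) E \<le> \<alpha> + \<beta>"
proof -
  have "ennreal (measure_pmf.prob (bind_pmf p g) E) = (\<integral>\<^sup>+x. emeasure (g x) E \<partial>p)"
    by (simp flip: measure_pmf.emeasure_eq_measure)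
  also have "\<dots> \<le> (\<integral>\<^sup>+x. indicator B x + ennreal \<beta> \<partial>p)"
  proof (rule nn_integral_mono_AE)
    have "emeasure (g x) E \<le> indicator B x + ennreal \<beta>" if "x \<in> set_pmf p" for x
    proof (cases "x \<in> B")
      case True
      have "emeasure (g x) E \<le> 1 + 0" by (simp add: measure_pmf.emeasure_le_1)
      also have "\<dots> \<le> 1 + ennreal \<beta>" by (intro add_mono) auto
      finally show ?thesis using True by simp
    next
      case False
      then show ?thesis using assms(2)[OF that False]
        by (simp add: measure_pmf.emeasure_eq_measure ennreal_leI)
    qed
    then show "AE x in measure_pmf p. emeasure (g x) E \<le> indicator B x + ennreal \<beta>"
      by (simp add: AE_measure_pmf_iff)
  qed
  also have "\<dots> = ennreal (measure_pmf.prob p B + \<beta>)"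
    using assms(3) by (subst nn_integral_add) (auto simp: measure_pmf.emeasure_eq_measure)
  also have "\<dots> \<le> ennreal (\<alpha> + \<beta>)" using assms(1) by (intro ennreal_leI) simp
  finally have "ennreal (measure_pmf.prob (bind_pmf p g) E) \<le> ennreal (\<alpha> + \<beta>)" .
  moreover have "0 \<le> \<alpha> + \<beta>" using assms(1,3) measure_nonneg[of p B] by linarith
  ultimately show ?thesis by (simp add: ennreal_le_iff)
qed

text \<open>The output is given as a functional of a total oracle; the tree feeds it the oracle that
  agrees with the answers on the queried points and with \<open>g\<close> elsewhere.\<close>

primrec query_tree :: "'q list \<Rightarrow> (('q \<Rightarrow> real) \<Rightarrow> 'r) \<Rightarrow> ('q \<Rightarrow> real) \<Rightarrow> ('q, 'r) decision_tree" where
  "query_tree [] \<Phi> g = Output (\<Phi> g)"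
| "query_tree (x # xs) \<Phi> g = Query x (query_tree xs \<Phi> (g(x := -1))) (query_tree xs \<Phi> (g(x := 1)))"

lemma query_points_query_tree: "query_points (query_tree xs \<Phi> g) = set xs"
  by (induction xs arbitrary: g) auto

lemma num_queries_query_tree: "num_queries f (query_tree xs \<Phi> g) = length xs"
  by (induction xs arbitrary: g) auto

text \<open>The answers must be 1 or -1 because \<open>run\<close> treats every other answer as -1,
  whereas the right-hand side sees the true value.\<close>

lemma run_query_tree:
  assumes "\<And>x. x \<in> set xs \<Longrightarrow> f x = 1 \<or> f x = -1"
  shows "run f (query_tree xs \<Phi> g) = \<Phi> (\<lambda>x. if x \<in> set xs then f x else g x)"
  using assms
proof (induction xs arbitrary: g)
  case (Cons a xs)
  have *: "run f (query_tree (a # xs) \<Phi> g) = run f (query_tree xs \<Phi> (g(a := f a)))"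
    using Cons.prems[of a] by auto
  have "run f (query_tree xs \<Phi> (g(a := f a))) = \<Phi> (\<lambda>x. if x \<in> set xs then f x else (g(a := f a)) x)"
    using Cons by auto
  also have "(\<lambda>x. if x \<in> set xs then f x else (g(a := f a)) x) = (\<lambda>x. if x \<in> set (a # xs) then f x else g x)"
    by auto
  finally show ?case using * by (rule trans[rotated])
qed simp

section \<open>Noise and influences\<close>

definition noise_space :: "nat \<Rightarrow> nat \<Rightarrow> (nat \<Rightarrow> nat) set" where
  "noise_space n q = {..<n} \<rightarrow>\<^sub>E {..<2 * q}"

text \<open>For uniform \<open>r\<close> in \<open>noise_space n q\<close> every coordinate is negated with probability
  \<open>1 / (2 * q)\<close>, i.e. the noise rate is \<open>\<rho> = 1 - 1 / q\<close>.\<close>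

definition noisy :: "nat \<Rightarrow> (nat \<Rightarrow> nat) \<Rightarrow> (nat \<Rightarrow> real) \<Rightarrow> nat \<Rightarrow> real" where
  "noisy n r x = (\<lambda>i\<in>{..<n}. (if r i = 0 then -1 else 1) * x i)"

definition flip :: "nat \<Rightarrow> nat set \<Rightarrow> (nat \<Rightarrow> real) \<Rightarrow> nat \<Rightarrow> real" where
  "flip n B x = (\<lambda>i\<in>{..<n}. if i \<in> B then - x i else x i)"

definition hashed_point :: "nat \<Rightarrow> (nat \<Rightarrow> nat) \<Rightarrow> (nat \<Rightarrow> real) \<Rightarrow> (nat \<Rightarrow> real) \<Rightarrow> nat \<Rightarrow> real" where
  "hashed_point n b z y = (\<lambda>i\<in>{..<n}. z i * y (b i))"

text \<open>Characterises the \<open>A\<close> for which \<open>chi A\<close> is constant on the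
  hashed points of a given shift: every \<open>y j\<close> occurs to an even power.\<close>

definition balanced :: "(nat \<Rightarrow> nat) \<Rightarrow> nat set \<Rightarrow> bool" where
  "balanced b A \<longleftrightarrow> (\<forall>j. even (card {i \<in> A. b i = j}))"

lemma finite_noise_space: "finite (noise_space n q)"
  by (simp add: noise_space_def finite_PiE)

lemma noise_space_nonempty: "1 \<le> q \<Longrightarrow> noise_space n q \<noteq> {}"
  by (auto simp: noise_space_def PiE_eq_empty_iff lessThan_empty_iff)

lemma noisy_in_cube: "x \<in> cube n \<Longrightarrow> noisy n r x \<in> cube n"
  using cube_values[of x n] by (fastforce simp: noisy_def cube_def)

lemma flip_in_cube: "x \<in> cube n \<Longrightarrow> flip n B x \<in> cube n"
  using cube_values[of x n] by (fastforce simp: flip_def cube_def)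

lemma hashed_point_in_cube:
  assumes "b \<in> {..<n} \<rightarrow>\<^sub>E {..<m}" "z \<in> cube n" "y \<in> cube m"
  shows "hashed_point n b z y \<in> cube n"
proof -
  have "z i * y (b i) = 1 \<or> z i * y (b i) = -1" if "i < n" for i
  proof -
    have "b i < m" using assms(1) that by auto
    then show ?thesis using cube_values[OF assms(2) that] cube_values[OF assms(3), of "b i"] by auto
  qed
  then show ?thesis by (auto simp: hashed_point_def cube_def)
qed

lemma chi_flip:
  assumes "U \<subseteq> {..<n}"
  shows "chi U (flip n B x) = (-1) ^ card (U \<inter> B) * chi U x"
proof -
  have fin: "finite U" using assms finite_subset by blast
  have "chi U (flip n B x) = (\<Prod>i\<in>U. (if i \<in> B then -1 else 1) * x i)"
    unfolding chi_def using assms by (intro prod.cong) (auto simp: flip_def)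
  also have "\<dots> = (\<Prod>i\<in>U. if i \<in> B then -1 else 1) * chi U x"
    by (simp add: prod.distrib chi_def)
  also have "(\<Prod>i\<in>U. if i \<in> B then -1 else (1::real)) = (-1) ^ card (U \<inter> B)"
    using fin by (simp add: prod.If_cases Int_def)
  finally show ?thesis .
qed

lemma avg_chi_noisy:
  assumes "U \<subseteq> {..<n}" "1 \<le> q"
  shows "avg (noise_space n q) (\<lambda>r. chi U (noisy n r x)) = (1 - 1 / q) ^ card U * chi U x"
proof -
  let ?s = "\<lambda>c::nat. if c = 0 then -1 else (1::real)"
  have "avg (noise_space n q) (\<lambda>r. chi U (noisy n r x)) = avg (noise_space n q) (\<lambda>r. (\<Prod>i\<in>U. ?s (r i)) * chi U x)"
    using assms by (intro avg_cong) (auto simp: chi_def noisy_def simp flip: prod.distrib intro!: prod.cong)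
  also have "\<dots> = (\<Prod>i\<in>U. avg {..<2*q} ?s) * chi U x"
    unfolding noise_space_def avg_mult_right using assms by (subst avg_PiE_prod) (auto simp: lessThan_empty_iff)
  also have "avg {..<2*q} ?s = 1 - 1 / q"
  proof -
    \<comment> \<open>Exactly one of the 2 * q equally likely values negates the coordinate.\<close>
    have "(\<Sum>c<2*q. ?s c) = (\<Sum>c<2*q. 1 - (if c = 0 then 2 else 0))" by (intro sum.cong) auto
    also have "\<dots> = 2 * q - 2" using assms by (simp add: sum_subtractf of_nat_diff)
    finally show ?thesis using assms by (simp add: avg_def field_simps)
  qed
  finally show ?thesis by simp
qed

text \<open>Substituting a hashed point turns \<open>chi A\<close> into \<open>chi A z\<close> times
  a monomial in \<open>y\<close> whose exponents are the bucket counts; a single odd exponent makes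
  the mean vanish.\<close>

lemma avg_chi_hashed:
  assumes "A \<subseteq> {..<n}" "b \<in> {..<n} \<rightarrow>\<^sub>E {..<m}"
  shows "avg (cube m) (\<lambda>y. chi A (hashed_point n b z y)) = (if balanced b A then chi A z else 0)"
proof -
  have fin: "finite A" using assms finite_subset by blast
  let ?c = "\<lambda>j. card {i \<in> A. b i = j}"
  have bA: "b ` A \<subseteq> {..<m}" using assms by (auto simp: PiE_iff)
  have "chi A (hashed_point n b z y) = (\<Prod>j<m. y j ^ ?c j) * chi A z" for y
  proof -
    have "chi A (hashed_point n b z y) = (\<Prod>i\<in>A. y (b i)) * chi A z"
      unfolding chi_def using assms
      by (auto simp: hashed_point_def mult.commute simp flip: prod.distrib intro!: prod.cong)
    also have "(\<Prod>i\<in>A. y (b i)) = (\<Prod>j<m. \<Prod>i\<in>{i\<in>A. b i = j}. y (b i))"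
      using fin bA by (subst prod.group) auto
    also have "\<dots> = (\<Prod>j<m. y j ^ ?c j)" by simp
    finally show ?thesis .
  qed
  then have "avg (cube m) (\<lambda>y. chi A (hashed_point n b z y)) = avg (cube m) (\<lambda>y. \<Prod>j<m. y j ^ ?c j) * chi A z"
    by (simp add: avg_mult_right)
  also have "avg (cube m) (\<lambda>y. \<Prod>j<m. y j ^ ?c j) = (\<Prod>j<m. avg {-1,1} (\<lambda>c. c ^ ?c j))"
    unfolding cube_def by (intro avg_PiE_prod) auto
  also have "(\<Prod>j<m. avg {-1,1::real} (\<lambda>c. c ^ ?c j)) = (\<Prod>j<m. if even (?c j) then 1 else 0)"
    by (intro prod.cong) (auto simp: avg_def)
  also have "\<dots> = (if balanced b A then 1 else 0)"
  proof -
    have "?c j = 0" if "\<not> j < m" for j using bA that by (auto simp: card_eq_0_iff)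
    then have "balanced b A \<longleftrightarrow> (\<forall>j<m. even (?c j))"
      unfolding balanced_def by (metis even_zero)
    then show ?thesis by auto
  qed
  finally show ?thesis by auto
qed

section \<open>The noise-smoothed function and its influences\<close>

locale noisy_oracle =
  fixes n q :: nat and f :: "(nat \<Rightarrow> real) \<Rightarrow> real"
  assumes q_pos: "1 \<le> q"
    and f_bool: "\<And>x. x \<in> cube n \<Longrightarrow> f x = 1 \<or> f x = -1"
begin

definition \<rho> :: real where "\<rho> = 1 - 1 / q"

text \<open>The Fourier coefficient of the smoothed function, that is, of the average of
  \<open>f\<close> over the noise (\<open>avg_noisy\<close>); \<open>weight\<close> and
  \<open>infl\<close> are the weights and influences of that function, not of
  \<open>f\<close>.\<close>

definition coef :: "nat set \<Rightarrow> real" where "coef U = \<rho> ^ card U * fourier n f U"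

definition weight :: "nat set \<Rightarrow> real" where "weight U = (coef U)\<^sup>2"

definition infl :: "nat \<Rightarrow> real" where "infl i = (\<Sum>U | U \<subseteq> {..<n} \<and> i \<in> U. weight U)"

lemma rho_bounds: "0 \<le> \<rho>" "\<rho> < 1"
  using q_pos by (auto simp: \<rho>_def)

lemma weight_nonneg: "0 \<le> weight U"
  by (simp add: weight_def)

lemma infl_nonneg: "0 \<le> infl i"
  by (simp add: infl_def sum_nonneg weight_nonneg)

text \<open>All \<open>u\<close> terms of the geometric series up to \<open>u\<close> are at least
  \<open>\<rho> ^ u\<close>, and the full series sums to 1 / (1 - \<rho>) = q.\<close>

lemma card_rho_power: "real u * \<rho> ^ u \<le> q"
proof -
  have "real u * \<rho> ^ u = (\<Sum>v<u. \<rho> ^ u)" by simp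
  also have "\<dots> \<le> (\<Sum>v<u. \<rho> ^ v)"
    using rho_bounds by (intro sum_mono power_decreasing) auto
  also have "\<dots> = (1 - \<rho> ^ u) * q" using rho_bounds q_pos by (simp add: sum_gp_strict) (simp add: \<rho>_def)
  also have "\<dots> \<le> 1 * real q" using rho_bounds by (intro mult_right_mono) auto
  finally show ?thesis by simp
qed

text \<open>Controls the expected weight of sets that a hash does not separate, since
  \<open>U\<close> has about (card U)^2 pairs that may collide. Each of the two factors
  \<open>\<rho> ^ card U\<close> in \<open>weight U\<close> absorbs one
  \<open>card U\<close>.\<close>

lemma sum_card_sq_weight: "(\<Sum>U\<in>Pow {..<n}. (real (card U))\<^sup>2 * weight U) \<le> (real q)\<^sup>2"
proof -
  have "(\<Sum>U\<in>Pow {..<n}. (real (card U))\<^sup>2 * weight U)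
      = (\<Sum>U\<in>Pow {..<n}. (card U * \<rho> ^ card U)\<^sup>2 * (fourier n f U)\<^sup>2)"
    by (simp add: weight_def coef_def power_mult_distrib mult.assoc)
  also have "\<dots> \<le> (\<Sum>U\<in>Pow {..<n}. (real q)\<^sup>2 * (fourier n f U)\<^sup>2)"
    using rho_bounds by (intro sum_mono mult_right_mono power_mono card_rho_power) auto
  also have "\<dots> = (real q)\<^sup>2" by (simp add: parseval_bool[OF f_bool] flip: sum_distrib_left)
  finally show ?thesis .
qed

lemma sum_infl: "(\<Sum>i<n. infl i) \<le> q"
proof -
  have "(\<Sum>i<n. infl i) = (\<Sum>i<n. \<Sum>U\<in>Pow {..<n}. if i \<in> U then weight U else 0)"
    unfolding infl_def by (intro sum.cong refl sum.mono_neutral_cong_left) auto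
  also have "\<dots> = (\<Sum>U\<in>Pow {..<n}. \<Sum>i<n. if i \<in> U then weight U else 0)"
    by (rule sum.swap)
  \<comment> \<open>Only one of the two powers of \<rho> is needed to absorb \<open>card U\<close>;
    the other is bounded by 1.\<close>
  also have "\<dots> = (\<Sum>U\<in>Pow {..<n}. (card U * \<rho> ^ card U) * (\<rho> ^ card U * (fourier n f U)\<^sup>2))"
  proof (intro sum.cong refl)
    fix U assume "U \<in> Pow {..<n}"
    then have "{..<n} \<inter> U = U" by auto
    then have "(\<Sum>i<n. if i \<in> U then weight U else 0) = card U * weight U"
      by (simp flip: sum.inter_restrict)
    then show "(\<Sum>i<n. if i \<in> U then weight U else 0) = (card U * \<rho> ^ card U) * (\<rho> ^ card U * (fourier n f U)\<^sup>2)"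
      by (simp add: weight_def coef_def power2_eq_square)
  qed
  also have "\<dots> \<le> (\<Sum>U\<in>Pow {..<n}. real q * (1 * (fourier n f U)\<^sup>2))"
    using rho_bounds by (intro sum_mono mult_mono card_rho_power) (auto simp: power_le_one)
  also have "\<dots> = q" by (simp add: parseval_bool[OF f_bool] flip: sum_distrib_left)
  finally show ?thesis .
qed

lemma avg_noisy:
  assumes "x \<in> cube n"
  shows "avg (noise_space n q) (\<lambda>r. f (noisy n r x)) = (\<Sum>U\<in>Pow {..<n}. coef U * chi U x)"
proof -
  have "avg (noise_space n q) (\<lambda>r. f (noisy n r x))
      = avg (noise_space n q) (\<lambda>r. \<Sum>U\<in>Pow {..<n}. fourier n f U * chi U (noisy n r x))"
    by (intro avg_cong fourier_expansion noisy_in_cube assms)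
  also have "\<dots> = (\<Sum>U\<in>Pow {..<n}. fourier n f U * avg (noise_space n q) (\<lambda>r. chi U (noisy n r x)))"
    by (simp add: avg_sum avg_mult_left)
  also have "\<dots> = (\<Sum>U\<in>Pow {..<n}. coef U * chi U x)"
    using q_pos by (intro sum.cong) (auto simp: avg_chi_noisy coef_def \<rho>_def)
  finally show ?thesis .
qed

text \<open>The influence of negating all of \<open>B\<close> simultaneously: precisely the
  characters with odd intersection change sign.\<close>

definition flip_infl :: "nat set \<Rightarrow> real" where
  "flip_infl B = (\<Sum>U | U \<subseteq> {..<n} \<and> odd (card (U \<inter> B)). weight U)"

text \<open>Independent \<open>r\<close> and \<open>r'\<close> make the mean of the product a
  product of means, so three values of \<open>f\<close> estimate without bias a quadratic form of
  the smoothed function, which itself cannot be queried. Odd sets contribute the factor (1 - (-1)) /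
  2 = 1, even ones 0.\<close>

lemma avg_flip_test:
  "avg (cube n \<times> noise_space n q \<times> noise_space n q)
     (\<lambda>(x, r, r'). f (noisy n r x) * (f (noisy n r' x) - f (noisy n r' (flip n B x))) / 2) = flip_infl B"
proof -
  let ?R = "noise_space n q"
  let ?p = "\<lambda>x. \<Sum>U\<in>Pow {..<n}. coef U * chi U x"
  have *: "avg ?R (\<lambda>r. avg ?R (\<lambda>r'. a r * (c r' - d r') / 2)) = avg ?R a * (avg ?R c - avg ?R d) / 2" for a c d
    by (subst avg_divide, subst avg_mult_left, subst avg_diff, subst avg_divide, subst avg_mult_right) (rule refl)
  have "avg (cube n \<times> ?R \<times> ?R)
     (\<lambda>(x, r, r'). f (noisy n r x) * (f (noisy n r' x) - f (noisy n r' (flip n B x))) / 2)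
    = avg (cube n) (\<lambda>x. avg ?R (\<lambda>r. f (noisy n r x)) *
        (avg ?R (\<lambda>r. f (noisy n r x)) - avg ?R (\<lambda>r. f (noisy n r (flip n B x))))) / 2"
    unfolding avg_Times prod.case * by (rule avg_divide)
  also have "\<dots> = avg (cube n) (\<lambda>x. ?p x * (\<Sum>U\<in>Pow {..<n}. coef U * (1 - (-1) ^ card (U \<inter> B)) * chi U x)) / 2"
    by (intro arg_cong[where f = "\<lambda>a. a / 2"] avg_cong)
       (simp add: avg_noisy flip_in_cube chi_flip algebra_simps flip: sum_subtractf)
  also have "\<dots> = (\<Sum>U\<in>Pow {..<n}. coef U * (coef U * (1 - (-1) ^ card (U \<inter> B)))) / 2"
    by (subst avg_polynomials) auto
  also have "\<dots> = (\<Sum>U\<in>Pow {..<n}. if odd (card (U \<inter> B)) then weight U else 0)"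
    unfolding sum_divide_distrib by (intro sum.cong) (auto simp: weight_def power2_eq_square)
  also have "\<dots> = flip_infl B"
    unfolding flip_infl_def by (intro sum.mono_neutral_cong_right) auto
  finally show ?thesis .
qed

text \<open>Collects the sets other than \<open>V\<close> whose characters agree with
  \<open>chi V\<close> up to sign on all hashed points. The common sign \<open>chi V z\<close> is
  split off so that a polynomial in \<open>z\<close> with coefficients \<open>coef U\<close>
  remains.\<close>

definition alias_error :: "(nat \<Rightarrow> nat) \<Rightarrow> nat set \<Rightarrow> (nat \<Rightarrow> real) \<Rightarrow> real" where
  "alias_error b V z =
     (\<Sum>U | U \<subseteq> {..<n} \<and> U \<noteq> V \<and> balanced b ((U - V) \<union> (V - U)). coef U * chi U z)"

text \<open>The gain from the random shift: cross terms between different \<open>U\<close> average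
  out.\<close>

lemma avg_alias_error_sq:
  "avg (cube n) (\<lambda>z. (alias_error b V z)\<^sup>2)
     = (\<Sum>U | U \<subseteq> {..<n} \<and> U \<noteq> V \<and> balanced b ((U - V) \<union> (V - U)). weight U)"
  unfolding alias_error_def power2_eq_square weight_def by (rule avg_polynomials) auto

lemma avg_hashed_polynomial:
  assumes "V \<subseteq> {..<n}" "b \<in> {..<n} \<rightarrow>\<^sub>E {..<m}" "z \<in> cube n"
  shows "avg (cube m) (\<lambda>y. chi V (hashed_point n b z y) *
           (\<Sum>U\<in>Pow {..<n}. coef U * chi U (hashed_point n b z y)))
         = coef V + chi V z * alias_error b V z"
proof -
  let ?D = "\<lambda>U. (U - V) \<union> (V - U)"
  have "avg (cube m) (\<lambda>y. chi V (hashed_point n b z y) *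
           (\<Sum>U\<in>Pow {..<n}. coef U * chi U (hashed_point n b z y)))
      = avg (cube m) (\<lambda>y. \<Sum>U\<in>Pow {..<n}. coef U * chi (?D U) (hashed_point n b z y))"
  proof (intro avg_cong)
    fix y assume "y \<in> cube m"
    then have p: "hashed_point n b z y \<in> cube n" using assms by (intro hashed_point_in_cube)
    then show "chi V (hashed_point n b z y) * (\<Sum>U\<in>Pow {..<n}. coef U * chi U (hashed_point n b z y))
      = (\<Sum>U\<in>Pow {..<n}. coef U * chi (?D U) (hashed_point n b z y))"
      unfolding sum_distrib_left using assms(1)
      by (intro sum.cong refl) (simp add: mult.left_commute[of "chi V _"] mult.commute[of "chi V _"] chi_mult_chi[OF p])
  qed
  also have "\<dots> = (\<Sum>U\<in>Pow {..<n}. coef U * (if balanced b (?D U) then chi (?D U) z else 0))"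
    unfolding avg_sum avg_mult_left using assms by (intro sum.cong refl) (subst avg_chi_hashed, auto)
  also have "\<dots> = (\<Sum>U\<in>Pow {..<n}. coef U * (if balanced b (?D U) then chi V z * chi U z else 0))"
    using assms by (intro sum.cong refl) (simp add: mult.commute[of "chi V z"] chi_mult_chi)
  \<comment> \<open>The set \<open>U = V\<close> has empty, hence balanced, symmetric difference and
    yields the wanted coefficient; all others are aliases.\<close>
  also have "\<dots> = coef V * (chi V z * chi V z) +
      (\<Sum>U\<in>Pow {..<n} - {V}. coef U * (if balanced b (?D U) then chi V z * chi U z else 0))"
    using assms by (subst sum.remove[of _ V]) (auto simp: balanced_def)
  also have "(\<Sum>U\<in>Pow {..<n} - {V}. coef U * (if balanced b (?D U) then chi V z * chi U z else 0))
      = chi V z * alias_error b V z"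
    unfolding alias_error_def sum_distrib_left by (intro sum.mono_neutral_cong_right) auto
  also have "chi V z * chi V z = 1" using assms by (intro chi_square)
  finally show ?thesis by simp
qed

text \<open>Both errors, damping by noise and aliasing, are inner products with the Fourier
  transform of \<open>G\<close> on \<open>Pow W\<close>. Its norm is 1, so Cauchy-Schwarz bounds
  them without a factor depending on the number of subsets.\<close>

lemma corr_hashed:
  assumes W: "W \<subseteq> {..<n}" and G: "depends_only n W G" "\<And>x. x \<in> cube n \<Longrightarrow> G x = 1 \<or> G x = -1"
    and b: "b \<in> {..<n} \<rightarrow>\<^sub>E {..<m}" and z: "z \<in> cube n"
    and err: "(\<Sum>V\<in>Pow W. (alias_error b V z)\<^sup>2) \<le> \<delta>\<^sup>2" and \<delta>: "0 \<le> \<delta>"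
  shows "\<bar>avg (cube m \<times> noise_space n q) (\<lambda>(y, r). G (hashed_point n b z y) * f (noisy n r (hashed_point n b z y)))
           - avg (cube n) (\<lambda>x. G x * f x)\<bar> \<le> card W / q + \<delta>"
proof -
  let ?p = "hashed_point n b z" and ?g = "fourier n G"
  have finW: "finite W" using W finite_subset by blast
  have g1: "(\<Sum>V\<in>Pow W. (?g V)\<^sup>2) = 1"
    using plancherel_depends_only[OF G(1) W, of G] parseval_bool[OF G(2)] plancherel[of n G G]
    by (simp add: power2_eq_square)
  have f1: "(\<Sum>V\<in>Pow W. (fourier n f V)\<^sup>2) \<le> 1"
    using W by (subst parseval_bool[OF f_bool, symmetric]) (auto intro!: sum_mono2)
  have CS: "(\<Sum>V\<in>Pow W. \<bar>?g V\<bar> * \<bar>c V\<bar>) \<le> \<delta>'" if "(\<Sum>V\<in>Pow W. (c V)\<^sup>2) \<le> \<delta>'\<^sup>2" "0 \<le> \<delta>'" for c and \<delta>' :: real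
  proof -
    have "(\<Sum>V\<in>Pow W. \<bar>?g V\<bar> * \<bar>c V\<bar>) \<le> L2_set ?g (Pow W) * L2_set c (Pow W)"
      by (rule L2_set_mult_ineq)
    also have "\<dots> \<le> \<delta>'" using that real_le_lsqrt by (auto simp: L2_set_def g1 sum_nonneg)
    finally show ?thesis .
  qed
  have "avg (cube m \<times> noise_space n q) (\<lambda>(y, r). G (?p y) * f (noisy n r (?p y)))
      = avg (cube m) (\<lambda>y. G (?p y) * avg (noise_space n q) (\<lambda>r. f (noisy n r (?p y))))"
    by (simp add: avg_Times avg_mult_left)
  also have "\<dots> = avg (cube m) (\<lambda>y. \<Sum>V\<in>Pow W. ?g V * (chi V (?p y) * (\<Sum>U\<in>Pow {..<n}. coef U * chi U (?p y))))"
  proof (intro avg_cong)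
    fix y assume "y \<in> cube m"
    then have p: "?p y \<in> cube n" using b z by (intro hashed_point_in_cube)
    show "G (?p y) * avg (noise_space n q) (\<lambda>r. f (noisy n r (?p y)))
       = (\<Sum>V\<in>Pow W. ?g V * (chi V (?p y) * (\<Sum>U\<in>Pow {..<n}. coef U * chi U (?p y))))"
      unfolding avg_noisy[OF p] expansion_depends_only[OF G(1) W p]
      by (simp add: sum_distrib_right mult.assoc)
  qed
  also have "\<dots> = (\<Sum>V\<in>Pow W. ?g V * (coef V + chi V z * alias_error b V z))"
    unfolding avg_sum avg_mult_left using W b z
    by (intro sum.cong refl) (subst avg_hashed_polynomial, auto)
  finally have 1: "avg (cube m \<times> noise_space n q) (\<lambda>(y, r). G (?p y) * f (noisy n r (?p y)))
     = (\<Sum>V\<in>Pow W. ?g V * (coef V + chi V z * alias_error b V z))" .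
  have "\<bar>(\<Sum>V\<in>Pow W. ?g V * (coef V + chi V z * alias_error b V z)) - (\<Sum>V\<in>Pow W. ?g V * fourier n f V)\<bar>
      = \<bar>\<Sum>V\<in>Pow W. ?g V * (coef V - fourier n f V) + ?g V * (chi V z * alias_error b V z)\<bar>"
    by (simp add: algebra_simps flip: sum_subtractf)
  also have "\<dots> \<le> (\<Sum>V\<in>Pow W. \<bar>?g V * (coef V - fourier n f V) + ?g V * (chi V z * alias_error b V z)\<bar>)"
    by (rule sum_abs)
  also have "\<dots> \<le> (\<Sum>V\<in>Pow W. card W / q * (\<bar>?g V\<bar> * \<bar>fourier n f V\<bar>) + \<bar>?g V\<bar> * \<bar>alias_error b V z\<bar>)"
  proof (intro sum_mono order_trans[OF abs_triangle_ineq] add_mono)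
    fix V assume V: "V \<in> Pow W"
    \<comment> \<open>Bernoulli's inequality: noise damps a coefficient at \<open>V\<close> by a
      relative amount of at most card V / q.\<close>
    have "1 - real (card V) * (1 / q) \<le> \<rho> ^ card V"
      using Bernoulli_inequality[of "- (1 / q)" "card V"] q_pos by (simp add: \<rho>_def)
    moreover have "real (card V) * (1 / q) \<le> card W / q"
      using V finW by (auto intro!: divide_right_mono card_mono)
    moreover have "\<rho> ^ card V \<le> 1" using rho_bounds by (simp add: power_le_one)
    ultimately have "\<bar>\<rho> ^ card V - 1\<bar> \<le> card W / q" by linarith
    then have "\<bar>?g V\<bar> * (\<bar>\<rho> ^ card V - 1\<bar> * \<bar>fourier n f V\<bar>) \<le> \<bar>?g V\<bar> * (card W / q * \<bar>fourier n f V\<bar>)"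
      by (intro mult_left_mono mult_right_mono) auto
    then show "\<bar>?g V * (coef V - fourier n f V)\<bar> \<le> card W / q * (\<bar>?g V\<bar> * \<bar>fourier n f V\<bar>)"
      by (simp add: coef_def abs_mult algebra_simps flip: abs_mult)
    have "chi V z * chi V z = 1" using V W by (intro chi_square[OF z]) auto
    then have "\<bar>chi V z\<bar> = 1" by (auto simp: square_eq_1_iff)
    then show "\<bar>?g V * (chi V z * alias_error b V z)\<bar> \<le> \<bar>?g V\<bar> * \<bar>alias_error b V z\<bar>"
      by (simp add: abs_mult)
  qed
  also have "\<dots> = card W / q * (\<Sum>V\<in>Pow W. \<bar>?g V\<bar> * \<bar>fourier n f V\<bar>) + (\<Sum>V\<in>Pow W. \<bar>?g V\<bar> * \<bar>alias_error b V z\<bar>)"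
    by (simp only: sum.distrib sum_distrib_left)
  also have "\<dots> \<le> card W / q * 1 + \<delta>"
    using CS[of "fourier n f" 1] CS[of "\<lambda>V. alias_error b V z" \<delta>] f1 err \<delta>
    by (intro add_mono mult_left_mono) auto
  finally show ?thesis
    unfolding 1 plancherel_depends_only[OF G(1) W] by simp
qed

end

section \<open>Hashing the coordinates\<close>

definition hash_space :: "nat \<Rightarrow> nat \<Rightarrow> (nat \<Rightarrow> nat) set" where
  "hash_space n m = {..<n} \<rightarrow>\<^sub>E {..<m}"

lemma finite_hash_space: "finite (hash_space n m)"
  by (simp add: hash_space_def finite_PiE)

lemma hash_space_nonempty: "1 \<le> m \<Longrightarrow> hash_space n m \<noteq> {}"
  by (auto simp: hash_space_def PiE_eq_empty_iff lessThan_empty_iff)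

lemma avg_collision:
  assumes "i < n" "i' < n" "i \<noteq> i'" "1 \<le> m"
  shows "avg (hash_space n m) (\<lambda>b. if b i = b i' then 1 else 0) = 1 / m"
proof -
  \<comment> \<open>The collision is split by its common bucket \<open>j\<close>, which makes it a
    sum of products to which independence applies.\<close>
  have "avg (hash_space n m) (\<lambda>b. if b i = b i' then 1 else 0)
      = avg (hash_space n m) (\<lambda>b. \<Sum>j<m. \<Prod>l\<in>{i, i'}. if b l = j then 1 else 0)"
  proof (intro avg_cong)
    fix b assume "b \<in> hash_space n m"
    then have "b i < m" using assms by (auto simp: hash_space_def)
    have "(\<Sum>j<m. \<Prod>l\<in>{i, i'}. if b l = j then 1 else 0) = (\<Sum>j<m. if b i = j then (if b i' = b i then 1 else 0) else (0::real))"
      using assms by (intro sum.cong) auto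
    then show "(if b i = b i' then 1 else 0) = (\<Sum>j<m. \<Prod>l\<in>{i, i'}. if b l = j then 1 else (0::real))"
      using \<open>b i < m\<close> by simp
  qed
  also have "\<dots> = (\<Sum>j<m. avg (hash_space n m) (\<lambda>b. \<Prod>l\<in>{i, i'}. if b l = j then 1 else 0))"
    by (rule avg_sum)
  also have "\<dots> = (\<Sum>j<m. \<Prod>l\<in>{i, i'}. avg {..<m} (\<lambda>c. if c = j then 1 else 0))"
    unfolding hash_space_def using assms by (intro sum.cong refl avg_PiE_prod) (auto simp: lessThan_empty_iff)
  also have "\<dots> = (\<Sum>j<m. 1 / (real m * m))"
    using assms by (intro sum.cong) (auto simp: avg_def)
  also have "\<dots> = 1 / m" using assms by simp
  finally show ?thesis .
qed

lemma avg_not_inj: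
  assumes "U \<subseteq> {..<n}" "1 \<le> m"
  shows "avg (hash_space n m) (\<lambda>b. if inj_on b U then 0 else 1) \<le> (real (card U))\<^sup>2 / m"
proof -
  have fin: "finite U" using assms finite_subset by blast
  have "avg (hash_space n m) (\<lambda>b. if inj_on b U then 0 else 1)
      \<le> avg (hash_space n m) (\<lambda>b. \<Sum>i\<in>U. \<Sum>i'\<in>U - {i}. if b i = b i' then 1 else 0)"
  proof (intro avg_mono)
    fix b
    show "(if inj_on b U then 0 else 1) \<le> (\<Sum>i\<in>U. \<Sum>i'\<in>U - {i}. if b i = b i' then 1 else (0::real))"
    proof (cases "inj_on b U")
      case False
      then obtain i i' where i: "i \<in> U" "i' \<in> U - {i}" "b i = b i'" by (auto simp: inj_on_def)
      have "(1::real) = (if b i = b i' then 1 else 0)" using i by simp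
      also have "\<dots> \<le> (\<Sum>i'\<in>U - {i}. if b i = b i' then 1 else 0)"
        using fin i by (intro member_le_sum) auto
      also have "\<dots> \<le> (\<Sum>i\<in>U. \<Sum>i'\<in>U - {i}. if b i = b i' then 1 else 0)"
        using fin i by (intro member_le_sum[of i U "\<lambda>i. \<Sum>i'\<in>U - {i}. if b i = b i' then 1 else 0"] sum_nonneg) auto
      finally show ?thesis using False by simp
    qed (simp add: sum_nonneg)
  qed
  also have "\<dots> = (\<Sum>i\<in>U. \<Sum>i'\<in>U - {i}. 1 / m)"
    unfolding avg_sum using assms by (intro sum.cong refl avg_collision) auto
  also have "\<dots> \<le> (\<Sum>i\<in>U. \<Sum>i'\<in>U. 1 / m)"
    using fin by (intro sum_mono sum_mono2) auto
  also have "\<dots> = (real (card U))\<^sup>2 / m" by (simp add: power2_eq_square)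
  finally show ?thesis .
qed

text \<open>The bucket class of \<open>i\<close> in \<open>A\<close> is nonempty and even, so it is
  not a singleton.\<close>

lemma balanced_mate:
  assumes "balanced b A" "finite A" "i \<in> A"
  shows "\<exists>i'\<in>A. i' \<noteq> i \<and> b i' = b i"
proof (rule ccontr)
  assume "\<not> ?thesis"
  then have "{i' \<in> A. b i' = b i} = {i}" using assms by auto
  then have "card {i' \<in> A. b i' = b i} = 1" by simp
  then show False using assms(1) unfolding balanced_def by (metis odd_one)
qed

section \<open>Collisions and aliasing in terms of influences\<close>

context noisy_oracle
begin

definition collisions :: "(nat \<Rightarrow> nat) \<Rightarrow> real" where
  "collisions b = (\<Sum>U | U \<subseteq> {..<n} \<and> \<not> inj_on b U. weight U)"

text \<open>Quadratic in influences of total at most \<open>q\<close>, so its mean over hashes is at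
  most q^2 / m whatever \<open>n\<close> is. It governs heavy coordinates meeting each other, light
  ones meeting heavy ones, and light ones piling up in a bucket.\<close>

definition pair_mass :: "(nat \<Rightarrow> nat) \<Rightarrow> real" where
  "pair_mass b = (\<Sum>i<n. \<Sum>i'\<in>{..<n} - {i}. if b i = b i' then infl i * infl i' else 0)"

definition heavy :: "real \<Rightarrow> nat set" where
  "heavy \<tau> = {i. i < n \<and> \<tau> \<le> infl i}"

lemma collisions_nonneg: "0 \<le> collisions b"
  by (simp add: collisions_def sum_nonneg weight_nonneg)

lemma pair_mass_nonneg: "0 \<le> pair_mass b"
  by (simp add: pair_mass_def infl_nonneg sum_nonneg)

lemma avg_collisions:
  assumes "1 \<le> m"
  shows "avg (hash_space n m) collisions \<le> (real q)\<^sup>2 / m"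
proof -
  have "avg (hash_space n m) collisions = avg (hash_space n m) (\<lambda>b. \<Sum>U\<in>Pow {..<n}. weight U * (if inj_on b U then 0 else 1))"
    unfolding collisions_def by (intro avg_cong sum.mono_neutral_cong_left) auto
  also have "\<dots> = (\<Sum>U\<in>Pow {..<n}. weight U * avg (hash_space n m) (\<lambda>b. if inj_on b U then 0 else 1))"
    by (simp only: avg_sum avg_mult_left)
  also have "\<dots> \<le> (\<Sum>U\<in>Pow {..<n}. weight U * ((real (card U))\<^sup>2 / m))"
    using assms by (intro sum_mono mult_left_mono avg_not_inj) (auto simp: weight_nonneg)
  also have "\<dots> = (\<Sum>U\<in>Pow {..<n}. (real (card U))\<^sup>2 * weight U) / m"
    by (simp add: sum_divide_distrib mult.commute)
  also have "\<dots> \<le> (real q)\<^sup>2 / m" by (intro divide_right_mono sum_card_sq_weight) simp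
  finally show ?thesis .
qed

lemma avg_pair_mass:
  assumes "1 \<le> m"
  shows "avg (hash_space n m) pair_mass \<le> (real q)\<^sup>2 / m"
proof -
  have "avg (hash_space n m) pair_mass
      = avg (hash_space n m) (\<lambda>b. \<Sum>i<n. \<Sum>i'\<in>{..<n} - {i}. infl i * infl i' * (if b i = b i' then 1 else 0))"
    unfolding pair_mass_def by (intro avg_cong sum.cong) auto
  also have "\<dots> = (\<Sum>i<n. \<Sum>i'\<in>{..<n} - {i}. infl i * infl i' * (1 / m))"
    unfolding avg_sum avg_mult_left using assms by (intro sum.cong refl) (subst avg_collision, auto)
  also have "\<dots> \<le> (\<Sum>i<n. \<Sum>i'<n. infl i * infl i' * (1 / m))"
    by (intro sum_mono sum_mono2) (auto simp: infl_nonneg)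
  also have "\<dots> = (\<Sum>i<n. infl i)\<^sup>2 / m"
    by (simp add: power2_eq_square sum_product sum_divide_distrib)
  also have "\<dots> \<le> (real q)\<^sup>2 / m"
    by (intro divide_right_mono power_mono sum_infl) (auto simp: infl_nonneg sum_nonneg)
  finally show ?thesis .
qed

lemma pair_mass_ge:
  assumes "i < n" "A \<subseteq> {..<n} - {i}" "\<And>i'. i' \<in> A \<Longrightarrow> b i' = b i"
  shows "infl i * (\<Sum>i'\<in>A. infl i') \<le> pair_mass b"
proof -
  let ?g = "\<lambda>i. \<Sum>i'\<in>{..<n} - {i}. if b i = b i' then infl i * infl i' else 0"
  have "infl i * (\<Sum>i'\<in>A. infl i') = (\<Sum>i'\<in>A. if b i = b i' then infl i * infl i' else 0)"
    unfolding sum_distrib_left using assms by (intro sum.cong) auto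
  also have "\<dots> \<le> ?g i"
    using assms by (intro sum_mono2) (auto simp: infl_nonneg)
  also have "\<dots> \<le> pair_mass b"
    unfolding pair_mass_def using assms by (intro member_le_sum[of i _ ?g]) (auto simp: infl_nonneg sum_nonneg)
  finally show ?thesis .
qed

text \<open>A single colliding pair of heavy coordinates would already contribute \<tau>^2.\<close>

lemma inj_on_heavy:
  assumes "pair_mass b < \<tau>\<^sup>2" "0 < \<tau>"
  shows "inj_on b (heavy \<tau>)"
proof (rule inj_onI, rule ccontr)
  fix i i' assume *: "i \<in> heavy \<tau>" "i' \<in> heavy \<tau>" "b i = b i'" "i \<noteq> i'"
  have "\<tau>\<^sup>2 \<le> infl i * infl i'"
    using * assms unfolding power2_eq_square by (intro mult_mono) (auto simp: heavy_def infl_nonneg)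
  also have "\<dots> \<le> pair_mass b" using pair_mass_ge[of i "{i'}" b] * by (auto simp: heavy_def)
  finally show False using assms by simp
qed

text \<open>Every element of the symmetric difference has a bucket mate there. If \<open>U\<close>
  lay inside \<open>H\<close>, mates would violate injectivity on \<open>H\<close>; so
  \<open>U\<close> has an element outside \<open>H\<close>, and its mate, not being in
  \<open>U\<close>, lies in \<open>V\<close> and hence in \<open>H\<close>.\<close>

lemma alias_cases:
  assumes inj: "inj_on b H" and "V \<subseteq> H" "U \<noteq> V" "finite U" "finite V"
    and bal: "balanced b ((U - V) \<union> (V - U))" and injU: "inj_on b U"
  shows "\<exists>i\<in>U - H. b i \<in> b ` H"
proof -
  have fin: "finite ((U - V) \<union> (V - U))" using assms by auto
  have "\<not> U \<subseteq> H"
  proof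
    assume "U \<subseteq> H"
    obtain i where i: "i \<in> (U - V) \<union> (V - U)" using \<open>U \<noteq> V\<close> by auto
    from balanced_mate[OF bal fin i] obtain i' where "i' \<in> (U - V) \<union> (V - U)" "i' \<noteq> i" "b i' = b i" by auto
    then show False using i \<open>U \<subseteq> H\<close> \<open>V \<subseteq> H\<close> inj by (auto dest: inj_onD)
  qed
  then obtain i where i: "i \<in> U" "i \<notin> H" by auto
  then have "i \<in> (U - V) \<union> (V - U)" using \<open>V \<subseteq> H\<close> by auto
  from balanced_mate[OF bal fin this] obtain i' where i': "i' \<in> (U - V) \<union> (V - U)" "i' \<noteq> i" "b i' = b i" by auto
  then have "i' \<notin> U" using injU i by (auto dest: inj_onD)
  then have "i' \<in> H" using i' \<open>V \<subseteq> H\<close> by auto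
  then show ?thesis using i i'(3) by (metis DiffI image_eqI)
qed

text \<open>If \<open>V\<close> and \<open>V'\<close> both match the bucket parities of
  \<open>U\<close>, their symmetric difference is balanced; inside \<open>H\<close>, where the hash
  is injective, it must be empty. Hence each \<open>U\<close> is charged to one \<open>V\<close>
  only, which avoids a factor exponential in the number of heavy coordinates.\<close>

lemma alias_unique:
  assumes inj: "inj_on b H" and sub: "V \<subseteq> H" "V' \<subseteq> H" and fin: "finite U" "finite V" "finite V'"
    and bal: "balanced b ((U - V) \<union> (V - U))" "balanced b ((U - V') \<union> (V' - U))"
  shows "V = V'"
proof (rule ccontr)
  assume "V \<noteq> V'"
  let ?D = "\<lambda>A B. (A - B) \<union> (B - A)"
  have "even (card {i \<in> ?D V V'. b i = j})" for j
  proof -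
    let ?f = "\<lambda>A. {i \<in> A. b i = j}"
    have eq: "?f (?D V V') = ?D (?f (?D U V)) (?f (?D U V'))" by auto
    have "even (card (?D A B))" if "finite A" "finite B" "even (card A)" "even (card B)" for A B :: "nat set"
    proof -
      have "card (?D A B) = card (A - B) + card (B - A)"
        using that by (intro card_Un_disjoint) auto
      moreover have "card (A - B) + card (A \<inter> B) = card A" "card (B - A) + card (A \<inter> B) = card B"
        using that card_Int_Diff[of A B] card_Int_Diff[of B A] by (simp_all add: Int_commute)
      ultimately have "card (?D A B) + 2 * card (A \<inter> B) = card A + card B" by linarith
      then show ?thesis using that by presburger
    qed
    then show ?thesis unfolding eq using bal fin by (simp add: balanced_def)
  qed
  then have b: "balanced b (?D V V')" by (simp add: balanced_def)
  obtain i where i: "i \<in> ?D V V'" using \<open>V \<noteq> V'\<close> by auto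
  from balanced_mate[OF b _ i] fin obtain i' where "i' \<in> ?D V V'" "i' \<noteq> i" "b i' = b i" by auto
  then show False using i sub inj by (auto dest: inj_onD)
qed

text \<open>Each \<open>U\<close> is charged once: to \<open>collisions\<close> if the hash is not
  injective on it, otherwise to a light element that shares a bucket with a heavy
  coordinate.\<close>

lemma avg_alias_error_heavy:
  assumes inj: "inj_on b (heavy \<tau>)" and \<tau>: "0 < \<tau>"
  shows "avg (cube n) (\<lambda>z. \<Sum>V\<in>Pow (heavy \<tau>). (alias_error b V z)\<^sup>2) \<le> collisions b + pair_mass b / \<tau>"
proof -
  let ?H = "heavy \<tau>" and ?P = "Pow {..<n}"
  let ?bal = "\<lambda>U V. U \<noteq> V \<and> balanced b ((U - V) \<union> (V - U))"
  \<comment> \<open>The light coordinates hashed to the bucket of a heavy one.\<close>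
  define L where "L = {i. i < n \<and> i \<notin> ?H \<and> b i \<in> b ` ?H}"
  have finH: "finite ?H" "?H \<subseteq> {..<n}" by (auto simp: heavy_def)
  have finL: "finite L" "L \<subseteq> {..<n}" by (auto simp: L_def)
  have finV: "finite V" if "V \<subseteq> ?H" for V using that finH finite_subset by blast
  have "avg (cube n) (\<lambda>z. \<Sum>V\<in>Pow ?H. (alias_error b V z)\<^sup>2)
      = (\<Sum>V\<in>Pow ?H. \<Sum>U\<in>?P. if ?bal U V then weight U else 0)"
    unfolding avg_sum avg_alias_error_sq
    by (intro sum.cong refl sum.mono_neutral_cong_left) auto
  also have "\<dots> = (\<Sum>U\<in>?P. \<Sum>V\<in>Pow ?H. if ?bal U V then weight U else 0)"
    by (rule sum.swap)
  also have "\<dots> \<le> (\<Sum>U\<in>?P. (if inj_on b U then 0 else weight U) + (\<Sum>i\<in>L. if i \<in> U then weight U else 0))"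
  proof (intro sum_mono)
    fix U assume "U \<in> ?P"
    then have U: "U \<subseteq> {..<n}" "finite U" using finite_subset by auto
    show "(\<Sum>V\<in>Pow ?H. if ?bal U V then weight U else 0)
        \<le> (if inj_on b U then 0 else weight U) + (\<Sum>i\<in>L. if i \<in> U then weight U else 0)"
    proof (cases "\<exists>V\<in>Pow ?H. ?bal U V")
      case False
      then have "(\<Sum>V\<in>Pow ?H. if ?bal U V then weight U else 0) = 0" by (intro sum.neutral) auto
      then show ?thesis by (simp add: weight_nonneg sum_nonneg)
    next
      case True
      then obtain V0 where V0: "V0 \<subseteq> ?H" "?bal U V0" by auto
      have "(\<Sum>V\<in>Pow ?H. if ?bal U V then weight U else 0) \<le> (\<Sum>V\<in>Pow ?H. if V = V0 then weight U else 0)"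
      proof (rule sum_mono)
        fix V assume "V \<in> Pow ?H"
        then have V: "V \<subseteq> ?H" by simp
        show "(if ?bal U V then weight U else 0) \<le> (if V = V0 then weight U else 0)"
        proof (cases "?bal U V")
          case True
          then have "V = V0"
            using alias_unique[OF inj V V0(1) U(2) finV[OF V] finV[OF V0(1)]] V0(2) by blast
          then show ?thesis unfolding if_P[OF True] by simp
        next
          case False
          then show ?thesis unfolding if_not_P[OF False] by (simp add: weight_nonneg)
        qed
      qed
      also have "\<dots> = weight U" using V0 finH by simp
      also have "\<dots> \<le> (if inj_on b U then 0 else weight U) + (\<Sum>i\<in>L. if i \<in> U then weight U else 0)"
      proof (cases "inj_on b U")
        case True
        then obtain i where "i \<in> U - ?H" "b i \<in> b ` ?H"
          using alias_cases[OF inj V0(1) _ U(2) finV[OF V0(1)] _ True] V0(2) by blast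
        then have "i \<in> L" "i \<in> U" using U by (auto simp: L_def)
        then have "weight U \<le> (\<Sum>i\<in>L. if i \<in> U then weight U else 0)"
          using member_le_sum[of i L "\<lambda>i. if i \<in> U then weight U else 0"] finL by (simp add: weight_nonneg)
        then show ?thesis using True by simp
      qed (auto simp: weight_nonneg sum_nonneg)
      finally show ?thesis .
    qed
  qed
  also have "\<dots> = (\<Sum>U\<in>?P. if inj_on b U then 0 else weight U) + (\<Sum>i\<in>L. \<Sum>U\<in>?P. if i \<in> U then weight U else 0)"
    by (subst sum.swap) (rule sum.distrib)
  also have "(\<Sum>U\<in>?P. if inj_on b U then 0 else weight U) = collisions b"
    unfolding collisions_def by (intro sum.mono_neutral_cong_right) auto
  also have "(\<Sum>i\<in>L. \<Sum>U\<in>?P. if i \<in> U then weight U else 0) = (\<Sum>i\<in>L. infl i)"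
    unfolding infl_def by (intro sum.cong refl sum.mono_neutral_cong_right) auto
  also have "(\<Sum>i\<in>L. infl i) \<le> pair_mass b / \<tau>"
  proof -
    \<comment> \<open>Each \<open>i\<close> in \<open>L\<close> has a heavy partner, so its pairs
      weigh at least \<open>\<tau> * infl i\<close>.\<close>
    have "\<tau> * (\<Sum>i\<in>L. infl i) \<le> (\<Sum>i\<in>L. \<Sum>h\<in>{..<n} - {i}. if b i = b h then infl i * infl h else 0)"
      unfolding sum_distrib_left
    proof (rule sum_mono)
      fix i assume "i \<in> L"
      then obtain h where h: "h \<in> ?H" "b i = b h" "h \<noteq> i" by (auto simp: L_def)
      have "\<tau> * infl i \<le> infl i * infl h"
        using h by (subst mult.commute, intro mult_left_mono) (auto simp: heavy_def infl_nonneg)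
      also have "\<dots> = (if b i = b h then infl i * infl h else 0)" using h by simp
      also have "\<dots> \<le> (\<Sum>h\<in>{..<n} - {i}. if b i = b h then infl i * infl h else 0)"
        using h finH by (intro member_le_sum[of h _ "\<lambda>h. if b i = b h then infl i * infl h else 0"]) (auto simp: infl_nonneg)
      finally show "\<tau> * infl i \<le> (\<Sum>h\<in>{..<n} - {i}. if b i = b h then infl i * infl h else 0)" .
    qed
    also have "\<dots> \<le> pair_mass b"
      unfolding pair_mass_def using finL by (intro sum_mono2) (auto simp: infl_nonneg sum_nonneg)
    finally show ?thesis using \<tau> by (simp add: field_simps)
  qed
  finally show ?thesis by simp
qed

section \<open>Influence of a half bucket versus influence of its members\<close>

lemma flip_infl_le:
  assumes "B \<subseteq> {..<n}"
  shows "flip_infl B \<le> (\<Sum>i\<in>B. infl i)"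
proof -
  have finB: "finite B" using assms finite_subset by blast
  have "flip_infl B = (\<Sum>U\<in>Pow {..<n}. if odd (card (U \<inter> B)) then weight U else 0)"
    unfolding flip_infl_def by (intro sum.mono_neutral_cong_left) auto
  also have "\<dots> \<le> (\<Sum>U\<in>Pow {..<n}. \<Sum>i\<in>B. if i \<in> U then weight U else 0)"
  proof (rule sum_mono)
    fix U
    show "(if odd (card (U \<inter> B)) then weight U else 0) \<le> (\<Sum>i\<in>B. if i \<in> U then weight U else 0)"
    proof (cases "odd (card (U \<inter> B))")
      case True
      then have "U \<inter> B \<noteq> {}" by auto
      then obtain i where "i \<in> U" "i \<in> B" by auto
      then show ?thesis using True member_le_sum[of i B "\<lambda>i. if i \<in> U then weight U else 0"] finB
        by (simp add: weight_nonneg)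
    qed (auto simp: weight_nonneg sum_nonneg)
  qed
  also have "\<dots> = (\<Sum>i\<in>B. \<Sum>U\<in>Pow {..<n}. if i \<in> U then weight U else 0)" by (rule sum.swap)
  also have "\<dots> = (\<Sum>i\<in>B. infl i)"
    unfolding infl_def by (intro sum.cong refl sum.mono_neutral_cong_right) auto
  finally show ?thesis .
qed

text \<open>A set containing \<open>i\<close> either meets \<open>B\<close> in an odd number of
  elements or contains a second element of \<open>B\<close>.\<close>

lemma flip_infl_ge:
  assumes "B \<subseteq> {..<n}" "i \<in> B"
  shows "infl i \<le> flip_infl B + (\<Sum>i'\<in>B - {i}. infl i')"
proof -
  have finB: "finite B" using assms finite_subset by blast
  have "infl i = (\<Sum>U\<in>Pow {..<n}. if i \<in> U then weight U else 0)"
    unfolding infl_def by (intro sum.mono_neutral_cong_left) auto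
  also have "\<dots> \<le> (\<Sum>U\<in>Pow {..<n}. (if odd (card (U \<inter> B)) then weight U else 0) + (\<Sum>i'\<in>B - {i}. if i' \<in> U then weight U else 0))"
  proof (rule sum_mono)
    fix U
    show "(if i \<in> U then weight U else 0) \<le> (if odd (card (U \<inter> B)) then weight U else 0) + (\<Sum>i'\<in>B - {i}. if i' \<in> U then weight U else 0)"
    proof (cases "i \<in> U \<and> even (card (U \<inter> B))")
      case True
      then have "U \<inter> B \<noteq> {i}" by auto
      then obtain i' where "i' \<in> U" "i' \<in> B - {i}" using True assms by auto
      then show ?thesis using True member_le_sum[of i' "B - {i}" "\<lambda>i. if i \<in> U then weight U else 0"] finB
        by (simp add: weight_nonneg)
    qed (auto simp: weight_nonneg sum_nonneg)
  qed
  also have "\<dots> = (\<Sum>U\<in>Pow {..<n}. if odd (card (U \<inter> B)) then weight U else 0) +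
      (\<Sum>i'\<in>B - {i}. \<Sum>U\<in>Pow {..<n}. if i' \<in> U then weight U else 0)"
    by (subst sum.swap) (rule sum.distrib)
  also have "(\<Sum>U\<in>Pow {..<n}. if odd (card (U \<inter> B)) then weight U else 0) = flip_infl B"
    unfolding flip_infl_def by (intro sum.mono_neutral_cong_right) auto
  also have "(\<Sum>i'\<in>B - {i}. \<Sum>U\<in>Pow {..<n}. if i' \<in> U then weight U else 0) = (\<Sum>i'\<in>B - {i}. infl i')"
    unfolding infl_def by (intro sum.cong refl sum.mono_neutral_cong_right) auto
  finally show ?thesis .
qed

text \<open>Excludes that many light coordinates imitate a heavy one. If all were light, their total
  s would satisfy s * (s - \<tau>) \<le> \<tau>^2 / 2, the off-diagonal part of s^2 being bounded by
  \<open>pair_mass\<close>; but s \<ge> 3/2 * \<tau> gives at least 3/4 * \<tau>^2.\<close>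

lemma heavy_in_bucket:
  assumes B: "B \<subseteq> {..<n}" "\<And>i i'. i \<in> B \<Longrightarrow> i' \<in> B \<Longrightarrow> b i = b i'"
    and pm: "pair_mass b \<le> \<tau>\<^sup>2 / 2" and \<tau>: "0 < \<tau>" and large: "3 / 2 * \<tau> \<le> flip_infl B"
  shows "\<exists>i\<in>B. i \<in> heavy \<tau>"
proof (rule ccontr)
  assume "\<not> ?thesis"
  then have light: "infl i < \<tau>" if "i \<in> B" for i using that B by (auto simp: heavy_def)
  have finB: "finite B" using B finite_subset by blast
  let ?s = "\<Sum>i\<in>B. infl i"
  have s: "3 / 2 * \<tau> \<le> ?s" using flip_infl_le[OF B(1)] large by linarith
  have "?s * ?s = (\<Sum>i\<in>B. infl i * infl i + (\<Sum>i'\<in>B - {i}. infl i * infl i'))"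
    unfolding sum_product using finB by (intro sum.cong refl sum.remove) auto
  also have "\<dots> \<le> (\<Sum>i\<in>B. \<tau> * infl i + (\<Sum>i'\<in>{..<n} - {i}. if b i = b i' then infl i * infl i' else 0))"
  proof (intro sum_mono add_mono mult_right_mono)
    fix i assume i: "i \<in> B"
    then show "infl i \<le> \<tau>" using light by (simp add: less_imp_le)
    have "(\<Sum>i'\<in>B - {i}. infl i * infl i') = (\<Sum>i'\<in>B - {i}. if b i = b i' then infl i * infl i' else 0)"
      using B(2)[OF i] by (intro sum.cong) auto
    also have "\<dots> \<le> (\<Sum>i'\<in>{..<n} - {i}. if b i = b i' then infl i * infl i' else 0)"
      using B by (intro sum_mono2) (auto simp: infl_nonneg)
    finally show "(\<Sum>i'\<in>B - {i}. infl i * infl i') \<le> (\<Sum>i'\<in>{..<n} - {i}. if b i = b i' then infl i * infl i' else 0)" .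
  qed (simp add: infl_nonneg)
  also have "\<dots> \<le> \<tau> * ?s + pair_mass b"
    unfolding sum.distrib pair_mass_def sum_distrib_left[symmetric] using B
    by (intro add_left_mono sum_mono2) (auto simp: infl_nonneg sum_nonneg)
  finally have "?s * (?s - \<tau>) \<le> \<tau>\<^sup>2 / 2" using pm by (simp add: algebra_simps)
  moreover have "(3 / 2 * \<tau>) * (1 / 2 * \<tau>) \<le> ?s * (?s - \<tau>)"
    using s \<tau> by (intro mult_mono) auto
  ultimately have "3 / 4 * \<tau>\<^sup>2 \<le> \<tau>\<^sup>2 / 2" by (simp add: power2_eq_square)
  then show False using \<tau> by simp
qed

text \<open>The rest of the bucket has influence at most \<tau> / 2, as its product with
  \<open>infl i\<close> is part of \<open>pair_mass\<close>. The values 3/2 and 5/2 in these two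
  lemmas leave an error of \<tau> / 2 on either side of the acceptance level 2 * \<tau>.\<close>

lemma flip_infl_bucket:
  assumes B: "B \<subseteq> {..<n}" "\<And>i'. i' \<in> B \<Longrightarrow> b i' = b i" and i: "i \<in> B"
    and pm: "pair_mass b \<le> \<tau>\<^sup>2 / 2" and \<tau>: "0 < \<tau>" and large: "3 * \<tau> \<le> infl i"
  shows "5 / 2 * \<tau> \<le> flip_infl B"
proof -
  let ?s = "\<Sum>i'\<in>B - {i}. infl i'"
  have "3 * \<tau> * ?s \<le> infl i * ?s"
    using large by (intro mult_right_mono) (auto simp: infl_nonneg sum_nonneg)
  also have "\<dots> \<le> pair_mass b" 
  proof (rule pair_mass_ge)
    show "i < n" "B - {i} \<subseteq> {..<n} - {i}" using B(1) i by auto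
    show "b i' = b i" if "i' \<in> B - {i}" for i' using that by (intro B(2)) simp
  qed
  also have "\<dots> \<le> 3 * \<tau> * (\<tau> / 2)"
  proof -
    have "3 * \<tau> * (\<tau> / 2) = \<tau>\<^sup>2 / 2 + \<tau>\<^sup>2" by (simp add: power2_eq_square)
    then show ?thesis using pm zero_le_power2[of \<tau>] by linarith
  qed
  finally have "3 * \<tau> * ?s \<le> 3 * \<tau> * (\<tau> / 2)" .
  then have "?s \<le> \<tau> / 2" by (rule mult_left_le_imp_le) (use \<tau> in simp)
  then show ?thesis using flip_infl_ge[OF B(1) i] large by linarith
qed

end

section \<open>Juntas on influential coordinates\<close>

text \<open>Encodes bucket and shift sign in one number below 2 * m: the quotient by 2 is the
  bucket, odd means sign -1. \<open>bucket_value\<close> decodes it.\<close>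

definition refine :: "(nat \<Rightarrow> nat) \<Rightarrow> (nat \<Rightarrow> real) \<Rightarrow> nat \<Rightarrow> nat" where
  "refine b z i = 2 * b i + (if z i = 1 then 0 else 1)"

definition bucket :: "nat \<Rightarrow> (nat \<Rightarrow> nat) \<Rightarrow> nat \<Rightarrow> nat set" where
  "bucket n c j = {i. i < n \<and> c i = j}"

definition bucket_value :: "(nat \<Rightarrow> real) \<Rightarrow> nat \<Rightarrow> real" where
  "bucket_value y j = (if even j then 1 else -1) * y (j div 2)"

text \<open>The argument of a hypothesis as computable from \<open>S\<close> and \<open>y\<close>
  alone; \<open>feature_eq_fill\<close> relates it to the unknown coordinates.\<close>

definition feature :: "nat \<Rightarrow> nat \<Rightarrow> (nat \<Rightarrow> nat) \<Rightarrow> (nat \<Rightarrow> real) \<Rightarrow> nat \<Rightarrow> real" where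
  "feature k m S y = (\<lambda>j\<in>{..<k}. if S j < 2 * m then bucket_value y (S j) else 1)"

definition fill :: "nat \<Rightarrow> nat \<Rightarrow> (nat \<Rightarrow> nat) \<Rightarrow> (nat \<Rightarrow> real) \<Rightarrow> nat \<Rightarrow> real" where
  "fill k m S x = (\<lambda>j\<in>{..<k}. if S j < 2 * m then x j else 1)"

text \<open>In a pair \<open>(S, h)\<close> the \<open>j\<close>-th argument of \<open>h\<close> is the hidden coordinate of half bucket
  \<open>S j\<close>; the value \<open>S j = 2 * m\<close> means that this argument is unused and fixed to \<open>1\<close>.\<close>

definition hypotheses :: "nat \<Rightarrow> nat \<Rightarrow> ((nat \<Rightarrow> nat) \<times> ((nat \<Rightarrow> real) \<Rightarrow> real)) set" where
  "hypotheses k m = ({..<k} \<rightarrow>\<^sub>E {..2 * m}) \<times> bool_funs k"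

text \<open>Used arguments must come from distinct half buckets so that distinct coordinates, as
  \<open>coords\<close> demands, can be assigned to them.\<close>

definition candidates :: "nat \<Rightarrow> nat \<Rightarrow> nat set \<Rightarrow> ((nat \<Rightarrow> nat) \<times> ((nat \<Rightarrow> real) \<Rightarrow> real)) set" where
  "candidates k m Acc = {(S, h) \<in> hypotheses k m.
     (\<forall>j<k. S j < 2 * m \<longrightarrow> S j \<in> Acc) \<and> inj_on S {j. j < k \<and> S j < 2 * m}}"

section \<open>Freezing coordinates and completing coordinate lists\<close>

definition mix :: "nat \<Rightarrow> nat set \<Rightarrow> (nat \<Rightarrow> real) \<Rightarrow> (nat \<Rightarrow> real) \<Rightarrow> nat \<Rightarrow> real" where
  "mix n A x u = (\<lambda>i\<in>{..<n}. if i \<in> A then x i else u i)"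

lemma mix_in_cube: "x \<in> cube n \<Longrightarrow> u \<in> cube n \<Longrightarrow> mix n A x u \<in> cube n"
  by (auto simp: mix_def cube_def PiE_iff)

lemma avg_chi_mix:
  assumes "V \<subseteq> {..<n}"
  shows "avg (cube n) (\<lambda>u. chi V (mix n A x u)) = (if V \<subseteq> A then chi V x else 0)"
proof -
  have fin: "finite V" using assms finite_subset by blast
  let ?g = "\<lambda>i c. if i \<in> A then x i else c"
  have "avg (cube n) (\<lambda>u. chi V (mix n A x u)) = avg (cube n) (\<lambda>u. \<Prod>i\<in>V. ?g i (u i))"
    unfolding chi_def using assms by (intro avg_cong prod.cong) (auto simp: mix_def)
  also have "\<dots> = (\<Prod>i\<in>V. avg {-1, 1} (?g i))"
    unfolding cube_def using assms by (intro avg_PiE_prod) auto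
  also have "\<dots> = (\<Prod>i\<in>V. if i \<in> A then x i else 0)"
    by (intro prod.cong) (auto simp: avg_def)
  also have "\<dots> = (if V \<subseteq> A then chi V x else 0)"
  proof (cases "V \<subseteq> A")
    case True
    then show ?thesis unfolding chi_def by (simp add: subset_iff cong: prod.cong)
  next
    case False
    then show ?thesis using fin by (auto intro: prod_zero)
  qed
  finally show ?thesis .
qed

text \<open>Averaging over \<open>u\<close> is conditional expectation given the coordinates in
  \<open>A\<close> and keeps just the characters inside \<open>A\<close>. As an average of
  restrictions, it is attained or exceeded by a single restriction.\<close>

lemma avg_mix:
  assumes "A \<subseteq> {..<n}"
  shows "avg (cube n) (\<lambda>u. avg (cube n) (\<lambda>x. g (mix n A x u) * f x))
       = (\<Sum>V\<in>Pow A. fourier n g V * fourier n f V)"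
proof -
  have "avg (cube n) (\<lambda>u. avg (cube n) (\<lambda>x. g (mix n A x u) * f x))
      = avg (cube n) (\<lambda>x. avg (cube n) (\<lambda>u. g (mix n A x u)) * f x)"
    by (subst avg_swap) (simp only: avg_mult_right)
  also have "\<dots> = avg (cube n) (\<lambda>x. \<Sum>V\<in>Pow A. fourier n g V * (f x * chi V x))"
  proof (intro avg_cong)
    fix x assume x: "x \<in> cube n"
    have "avg (cube n) (\<lambda>u. g (mix n A x u)) = avg (cube n) (\<lambda>u. \<Sum>V\<in>Pow {..<n}. fourier n g V * chi V (mix n A x u))"
      using x by (intro avg_cong fourier_expansion mix_in_cube)
    also have "\<dots> = (\<Sum>V\<in>Pow {..<n}. fourier n g V * (if V \<subseteq> A then chi V x else 0))"
      unfolding avg_sum avg_mult_left by (intro sum.cong refl) (simp add: avg_chi_mix)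
    also have "\<dots> = (\<Sum>V\<in>Pow A. fourier n g V * chi V x)"
      using assms by (intro sum.mono_neutral_cong_right) auto
    finally show "avg (cube n) (\<lambda>u. g (mix n A x u)) * f x = (\<Sum>V\<in>Pow A. fourier n g V * (f x * chi V x))"
      by (simp add: sum_distrib_left mult_ac)
  qed
  also have "\<dots> = (\<Sum>V\<in>Pow A. fourier n g V * fourier n f V)"
    by (simp only: avg_sum avg_mult_left fourier_def)
  finally show ?thesis .
qed

text \<open>Hypotheses may use fewer than \<open>k\<close> arguments while \<open>coords\<close>
  asks for \<open>k\<close> distinct coordinates; \<open>k \<le> n\<close> leaves enough spare
  ones.\<close>

lemma extend_coords:
  assumes "J \<subseteq> {..<k}" "inj_on t J" "t ` J \<subseteq> {..<n}" "k \<le> n"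
  shows "\<exists>i\<in>coords n k. \<forall>j\<in>J. i j = t j"
proof -
  have fin: "finite J" using assms finite_subset by blast
  have "card ({..<k} - J) = k - card J" using assms fin by (simp add: card_Diff_subset)
  also have "\<dots> \<le> n - card J" using assms by simp
  also have "\<dots> = card ({..<n} - t ` J)"
    using assms fin by (simp add: card_Diff_subset card_image)
  finally obtain g where g: "g ` ({..<k} - J) \<subseteq> {..<n} - t ` J" "inj_on g ({..<k} - J)"
    using card_le_inj[of "{..<k} - J" "{..<n} - t ` J"] by auto
  define i where "i j = (if j \<in> J then t j else g j)" for j
  have "i j < n" if "j < k" for j
    using that g(1) assms(3) by (cases "j \<in> J") (auto simp: i_def)
  moreover have "inj_on i {..<k}"
  proof (rule inj_onI)
    fix j j' assume *: "j \<in> {..<k}" "j' \<in> {..<k}" "i j = i j'"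
    have cross: False if "a \<in> J" "a' \<notin> J" "a' \<in> {..<k}" "i a = i a'" for a a'
    proof -
      have "g a' \<notin> t ` J" using g(1) that by auto
      moreover have "g a' = t a" using that by (simp add: i_def)
      ultimately show False using \<open>a \<in> J\<close> by simp
    qed
    show "j = j'"
    proof (cases "j \<in> J"; cases "j' \<in> J")
      assume "j \<in> J" "j' \<in> J"
      then show ?thesis using * assms(2) by (auto simp: i_def dest: inj_onD)
    next
      assume "j \<notin> J" "j' \<notin> J"
      then show ?thesis using * g(2) by (auto simp: i_def dest: inj_onD)
    next
      assume "j \<in> J" "j' \<notin> J"
      then show ?thesis using * cross[of j j'] by auto
    next
      assume "j \<notin> J" "j' \<in> J"
      then show ?thesis using * cross[of j' j] by auto
    qed
  qed
  ultimately have "i \<in> coords n k" by (auto simp: coords_def)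
  then show ?thesis by (intro bexI[of _ i]) (auto simp: i_def)
qed

lemma proj_in_cube: "i \<in> coords n k \<Longrightarrow> x \<in> cube n \<Longrightarrow> proj k i x \<in> cube k"
  unfolding proj_def coords_def cube_def by (auto simp: PiE_iff Pi_iff)

lemma fill_in_cube: "x \<in> cube k \<Longrightarrow> fill k m S x \<in> cube k"
  by (auto simp: fill_def cube_def PiE_iff)

lemma bool_funs_values: "h \<in> bool_funs k \<Longrightarrow> x \<in> cube k \<Longrightarrow> h x = 1 \<or> h x = -1"
  by (auto simp: bool_funs_def PiE_iff)

text \<open>Knowing the half bucket suffices: its parity gives \<open>z (i j)\<close> and its
  quotient gives \<open>b (i j)\<close>, although \<open>i j\<close> itself stays unknown.\<close>

lemma feature_eq_fill:
  assumes "i \<in> coords n k" and "\<And>j. j < k \<Longrightarrow> S j < 2 * m \<Longrightarrow> refine b z (i j) = S j" and "z \<in> cube n"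
  shows "feature k m S y = fill k m S (proj k i (hashed_point n b z y))"
proof -
  have "bucket_value y (S j) = z (i j) * y (b (i j))" if "j < k" "S j < 2 * m" for j
  proof -
    have "i j < n" using assms(1) that by (auto simp: coords_def)
    then have "z (i j) = 1 \<or> z (i j) = -1" using assms(3) by (intro cube_values)
    moreover have "S j = 2 * b (i j) + (if z (i j) = 1 then 0 else 1)"
      using assms(2)[OF that] by (simp add: refine_def)
    ultimately show ?thesis by (auto simp: bucket_value_def)
  qed
  moreover have "i j < n" if "j < k" for j using assms(1) that by (auto simp: coords_def)
  ultimately show ?thesis
    by (auto simp: feature_def fill_def proj_def hashed_point_def fun_eq_iff restrict_def)
qed

lemma junta_of_hypothesis:
  assumes "i \<in> coords n k" "h \<in> bool_funs k"
  shows "(\<lambda>x\<in>cube n. h (fill k m S (proj k i x))) \<in> juntas n k"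
proof -
  have "(\<lambda>x\<in>cube n. h (fill k m S (proj k i x))) \<in> bool_funs n"
    using assms bool_funs_values[OF assms(2) fill_in_cube[OF proj_in_cube[OF assms(1)]]]
    by (auto simp: bool_funs_def)
  moreover have "proj k i x = proj k i y" if "\<forall>j<k. x (i j) = y (i j)" for x y
    using that by (auto simp: proj_def fun_eq_iff restrict_def)
  ultimately show ?thesis using assms(1) unfolding juntas_def by (auto intro!: bexI[of _ i]) metis
qed

lemma corr_le_max_corr: "l \<in> juntas n k \<Longrightarrow> corr n l f \<le> max_corr n k f"
  unfolding max_corr_def by (intro Max_ge) (auto simp: finite_juntas)

section \<open>Correlations attained through half buckets\<close>

context noisy_oracle
begin

text \<open>The lost correlation lives on sets containing a light coordinate. There \<open>f\<close>
  has squared mass at most 4 * k * 3 * \<tau>, and Cauchy-Schwarz against \<open>g\<close>, of norm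
  at most 1, finishes.\<close>

lemma drop_light_coordinates:
  assumes W: "W \<subseteq> {..<n}" "card W \<le> k" and A: "A \<subseteq> W" and light: "\<And>i. i \<in> W - A \<Longrightarrow> infl i \<le> 3 * \<tau>"
    and \<tau>: "\<tau> = 1 / (12 * (real q)\<^sup>2)" and q: "2 * k \<le> q"
    and g: "depends_only n W g" "\<And>x. x \<in> cube n \<Longrightarrow> g x = 1 \<or> g x = -1"
  shows "\<exists>u\<in>cube n. avg (cube n) (\<lambda>x. g x * f x) \<le> avg (cube n) (\<lambda>x. g (mix n A x u) * f x) + (real k + 1) / q"
proof -
  have fin: "finite W" by (rule finite_subset[OF W(1)]) simp
  let ?D = "Pow W - Pow A"
  \<comment> \<open>For at most \<open>k \<le> q / 2\<close> coordinates the damping is at least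
    1/2, so true weights are at most four times the smoothed ones.\<close>
  have f4: "(fourier n f V)\<^sup>2 \<le> 4 * weight V" if V: "V \<in> Pow W" for V
  proof -
    have "card V \<le> k" using V W(2) card_mono[OF fin, of V] by simp
    have "1 - real (card V) * (1 / q) \<le> \<rho> ^ card V"
      using Bernoulli_inequality[of "- (1 / q)" "card V"] q_pos by (simp add: \<rho>_def)
    moreover have "real (card V) * (1 / q) \<le> 1 / 2"
      using \<open>card V \<le> k\<close> q q_pos by (simp add: field_simps)
    ultimately have "1 / 2 \<le> \<rho> ^ card V" by linarith
    then have "(1 / 2)\<^sup>2 \<le> (\<rho> ^ card V)\<^sup>2" by (intro power_mono) auto
    then have "1 * (fourier n f V)\<^sup>2 \<le> (4 * (\<rho> ^ card V)\<^sup>2) * (fourier n f V)\<^sup>2"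
      by (intro mult_right_mono) (auto simp: power2_eq_square)
    then show ?thesis by (simp add: weight_def coef_def power_mult_distrib)
  qed
  have "(\<Sum>V\<in>?D. (fourier n f V)\<^sup>2) \<le> (\<Sum>V\<in>?D. 4 * (\<Sum>i\<in>W - A. if i \<in> V then weight V else 0))"
  proof (rule sum_mono)
    fix V assume V: "V \<in> ?D"
    then obtain i where "i \<in> V" "i \<in> W - A" by auto
    then have "weight V \<le> (\<Sum>i\<in>W - A. if i \<in> V then weight V else 0)"
      using member_le_sum[of i "W - A" "\<lambda>i. if i \<in> V then weight V else 0"] fin by (simp add: weight_nonneg)
    then show "(fourier n f V)\<^sup>2 \<le> 4 * (\<Sum>i\<in>W - A. if i \<in> V then weight V else 0)"
      using f4[of V] V by auto
  qed
  also have "\<dots> = 4 * (\<Sum>i\<in>W - A. \<Sum>V\<in>?D. if i \<in> V then weight V else 0)"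
    by (simp only: sum_distrib_left[symmetric]) (subst sum.swap, rule refl)
  also have "\<dots> \<le> 4 * (\<Sum>i\<in>W - A. 3 * \<tau>)"
  proof (intro mult_left_mono sum_mono)
    fix i assume i: "i \<in> W - A"
    have "(\<Sum>V\<in>?D. if i \<in> V then weight V else 0) \<le> (\<Sum>V\<in>Pow {..<n}. if i \<in> V then weight V else 0)"
      using W by (intro sum_mono2) (auto simp: weight_nonneg)
    also have "\<dots> = infl i" unfolding infl_def by (intro sum.mono_neutral_cong_right) auto
    finally show "(\<Sum>V\<in>?D. if i \<in> V then weight V else 0) \<le> 3 * \<tau>" using light[OF i] by linarith
  qed simp
  \<comment> \<open>This is where \<tau> is fixed: 4 * 3 * \<tau> = 1 / q^2.\<close>
  also have "\<dots> = real (card (W - A)) * (1 / (real q)\<^sup>2)" by (simp add: \<tau>)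
  also have "\<dots> \<le> (real k + 1)\<^sup>2 * (1 / (real q)\<^sup>2)"
  proof (intro mult_right_mono)
    have "card (W - A) \<le> k" using W fin card_mono[of W "W - A"] by auto
    then have "real (card (W - A)) \<le> real k" by simp
    moreover have "(real k + 1)\<^sup>2 = real k * real k + 2 * real k + 1"
      by (simp add: power2_eq_square algebra_simps)
    moreover have "0 \<le> real k * real k" by simp
    ultimately show "real (card (W - A)) \<le> (real k + 1)\<^sup>2" by linarith
  qed simp
  also have "\<dots> = ((real k + 1) / q)\<^sup>2" by (simp add: power_divide)
  finally have fD: "L2_set (fourier n f) ?D \<le> (real k + 1) / q"
    unfolding L2_set_def by (intro real_le_lsqrt) auto
  have "(\<Sum>V\<in>?D. (fourier n g V)\<^sup>2) \<le> 1"
    using W by (subst parseval_bool[OF g(2), symmetric]) (auto intro!: sum_mono2)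
  then have gD: "L2_set (fourier n g) ?D \<le> 1" by (simp add: L2_set_def)
  have "avg (cube n) (\<lambda>x. g x * f x) = (\<Sum>V\<in>Pow A. fourier n g V * fourier n f V) + (\<Sum>V\<in>?D. fourier n g V * fourier n f V)"
    unfolding plancherel_depends_only[OF g(1) W(1)] using A fin
    by (subst sum.subset_diff[of "Pow A" "Pow W"]) auto
  also have "(\<Sum>V\<in>?D. fourier n g V * fourier n f V) \<le> (\<Sum>V\<in>?D. \<bar>fourier n g V\<bar> * \<bar>fourier n f V\<bar>)"
    by (intro sum_mono) (metis abs_ge_self abs_mult)
  also have "\<dots> \<le> L2_set (fourier n g) ?D * L2_set (fourier n f) ?D"
    by (rule L2_set_mult_ineq)
  also have "\<dots> \<le> 1 * ((real k + 1) / q)" using fD gD by (intro mult_mono) auto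
  finally have "avg (cube n) (\<lambda>x. g x * f x) \<le> avg (cube n) (\<lambda>u. avg (cube n) (\<lambda>x. g (mix n A x u) * f x)) + (real k + 1) / q"
    using A W by (subst avg_mix) auto
  \<comment> \<open>Fixing one good \<open>u\<close> instead of averaging keeps the values in {-1,
    1}.\<close>
  moreover obtain u where "u \<in> cube n"
    "avg (cube n) (\<lambda>u. avg (cube n) (\<lambda>x. g (mix n A x u) * f x)) \<le> avg (cube n) (\<lambda>x. g (mix n A x u) * f x)"
    using exists_ge_avg[OF finite_cube cube_nonempty] by blast
  ultimately show ?thesis by (intro bexI[of _ u]) linarith+
qed

lemma light_junta:
  assumes i: "i \<in> coords n k" and J: "J \<subseteq> {..<k}" and l: "l \<in> bool_funs n"
    and dep: "\<forall>x\<in>cube n. \<forall>y\<in>cube n. (\<forall>j<k. x (i j) = y (i j)) \<longrightarrow> l x = l y"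
    and light: "\<And>j. j \<in> {..<k} - J \<Longrightarrow> infl (i j) \<le> 3 * \<tau>"
    and \<tau>: "\<tau> = 1 / (12 * (real q)\<^sup>2)" and q: "2 * k \<le> q"
    and S: "\<And>j. j < k \<Longrightarrow> S j < 2 * m \<longleftrightarrow> j \<in> J"
  shows "\<exists>h\<in>bool_funs k. corr n l f \<le> corr n (\<lambda>x. h (fill k m S (proj k i x))) f + (real k + 1) / q"
proof -
  have inj: "inj_on i {..<k}" and im: "i ` {..<k} \<subseteq> {..<n}" using i by (auto simp: coords_def)
  have 1: "card (i ` {..<k}) \<le> k" using card_image_le[of "{..<k}" i] by simp
  have 2: "depends_only n (i ` {..<k}) l" unfolding depends_only_def
  proof (intro ballI impI)
    fix x y assume xy: "x \<in> cube n" "y \<in> cube n" and "\<forall>a\<in>i ` {..<k}. x a = y a"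
    then have "\<forall>j<k. x (i j) = y (i j)" by simp
    then show "l x = l y" using dep xy by blast
  qed
  have 3: "infl a \<le> 3 * \<tau>" if "a \<in> i ` {..<k} - i ` J" for a using that light by auto
  have 4: "i ` J \<subseteq> i ` {..<k}" using J by auto
  obtain u where u: "u \<in> cube n"
    "avg (cube n) (\<lambda>x. l x * f x) \<le> avg (cube n) (\<lambda>x. l (mix n (i ` J) x u) * f x) + (real k + 1) / q"
    using drop_light_coordinates[OF im 1 4 3 \<tau> q 2 bool_funs_values[OF l]] by auto
  \<comment> \<open>Rebuilds a point of the large cube from the \<open>k\<close> arguments, with the
    dropped coordinates frozen as in \<open>u\<close>. The search over all \<open>h\<close> covers
    the resulting function without knowing \<open>u\<close>.\<close>
  define e where "e y = (\<lambda>a\<in>{..<n}. if a \<in> i ` J then y (inv_into {..<k} i a) else u a)" for y :: "nat \<Rightarrow> real"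
  have e_cube: "e y \<in> cube n" if "y \<in> cube k" for y
  proof -
    have "e y a = 1 \<or> e y a = -1" if "a < n" for a
    proof (cases "a \<in> i ` J")
      case True
      then have "inv_into {..<k} i a \<in> {..<k}" using J by (intro inv_into_into) auto
      then show ?thesis using True that cube_values[OF \<open>y \<in> cube k\<close>] by (simp add: e_def)
    next
      case False
      then show ?thesis using that cube_values[OF u(1)] by (simp add: e_def)
    qed
    moreover have "e y \<in> extensional {..<n}" by (simp add: e_def)
    ultimately show ?thesis unfolding cube_def PiE_iff by auto
  qed
  define h where "h = (\<lambda>y\<in>cube k. l (e y))"
  have "h \<in> bool_funs k"
    unfolding h_def bool_funs_def using bool_funs_values[OF l e_cube] by auto
  moreover have "corr n (\<lambda>x. h (fill k m S (proj k i x))) f = avg (cube n) (\<lambda>x. l (mix n (i ` J) x u) * f x)"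
    unfolding corr_avg
  proof (intro avg_cong)
    fix x assume x: "x \<in> cube n"
    have "e (fill k m S (proj k i x)) = mix n (i ` J) x u"
    proof
      fix a
      show "e (fill k m S (proj k i x)) a = mix n (i ` J) x u a"
      proof (cases "a < n \<and> a \<in> i ` J")
        case True
        then obtain j where j: "j \<in> J" "a = i j" by auto
        then have "inv_into {..<k} i a = j" using inj J by auto
        then show ?thesis using True j J S[of j] by (auto simp: e_def mix_def fill_def proj_def)
      qed (auto simp: e_def mix_def)
    qed
    then show "h (fill k m S (proj k i x)) * f x = l (mix n (i ` J) x u) * f x"
      using fill_in_cube[OF proj_in_cube[OF i x]] by (simp add: h_def)
  qed
  ultimately show ?thesis using u(2) by (intro bexI[of _ h]) (simp_all add: corr_avg)
qed

lemma hypothesis_corr: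
  assumes i: "i \<in> coords n k" and h: "h \<in> bool_funs k"
    and S: "\<And>j. j < k \<Longrightarrow> S j < 2 * m \<Longrightarrow> refine b z (i j) = S j \<and> i j \<in> heavy \<tau>"
    and b: "b \<in> hash_space n m" and z: "z \<in> cube n"
    and aliasing: "(\<Sum>V\<in>Pow (heavy \<tau>). (alias_error b V z)\<^sup>2) \<le> (1 / q)\<^sup>2"
  shows "\<bar>avg (cube m \<times> noise_space n q) (\<lambda>(y, r). h (feature k m S y) * f (noisy n r (hashed_point n b z y)))
          - corr n (\<lambda>x. h (fill k m S (proj k i x))) f\<bar> \<le> (real k + 1) / q"
proof -
  let ?J = "{j. j < k \<and> S j < 2 * m}"
  let ?G = "\<lambda>x. h (fill k m S (proj k i x))"
  have fin: "finite (heavy \<tau>)" by (simp add: heavy_def)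
  have WH: "i ` ?J \<subseteq> heavy \<tau>" using S by auto
  have Wn: "i ` ?J \<subseteq> {..<n}" using WH by (auto simp: heavy_def)
  have "depends_only n (i ` ?J) ?G"
  proof -
    have "fill k m S (proj k i x) = fill k m S (proj k i y)" if "\<forall>a\<in>i ` ?J. x a = y a" for x y
      using that by (auto simp: fill_def proj_def fun_eq_iff restrict_def)
    then show ?thesis unfolding depends_only_def by (metis (no_types, lifting))
  qed
  moreover have "?G x = 1 \<or> ?G x = -1" if "x \<in> cube n" for x
    using bool_funs_values[OF h fill_in_cube[OF proj_in_cube[OF i that]]] .
  moreover have "(\<Sum>V\<in>Pow (i ` ?J). (alias_error b V z)\<^sup>2) \<le> (1 / q)\<^sup>2"
    using WH fin by (intro order_trans[OF sum_mono2 aliasing]) auto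
  ultimately have "\<bar>avg (cube m \<times> noise_space n q) (\<lambda>(y, r). ?G (hashed_point n b z y) * f (noisy n r (hashed_point n b z y)))
      - avg (cube n) (\<lambda>x. ?G x * f x)\<bar> \<le> card (i ` ?J) / q + 1 / q"
    using Wn b z by (intro corr_hashed) (auto simp: hash_space_def)
  moreover have "card (i ` ?J) \<le> k"
  proof -
    have "card ?J \<le> card {..<k}" by (intro card_mono) auto
    then show ?thesis using card_image_le[of ?J i] by simp
  qed
  then have "card (i ` ?J) / q + 1 / q \<le> (real k + 1) / q"
    by (simp add: add_divide_distrib divide_right_mono)
  moreover have "?G (hashed_point n b z y) = h (feature k m S y)" for y
    using feature_eq_fill[OF i, of S m b z y] S z by simp
  ultimately show ?thesis unfolding corr_avg by simp
qed

lemma bucket_same_hash: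
  "i \<in> bucket n (refine b z) j \<Longrightarrow> i' \<in> bucket n (refine b z) j \<Longrightarrow> b i = b i'"
proof -
  have "refine b z a div 2 = b a" for a by (simp add: refine_def)
  then show "i \<in> bucket n (refine b z) j \<Longrightarrow> i' \<in> bucket n (refine b z) j \<Longrightarrow> b i = b i'"
    by (metis (mono_tags, lifting) bucket_def mem_Collect_eq)
qed

text \<open>The chosen hypothesis is a genuine junta, so its correlation is at most the maximum. An
  optimal junta stripped of its light coordinates is a candidate, so its score is at most the chosen
  one. Score and correlation differ by at most (k + 2) / q: k / q for noise, 1 / q for aliasing, 1 /
  q for sampling.\<close>

lemma maximiser_correct:
  fixes e0 :: "nat \<Rightarrow> real" and e1 :: "(nat \<Rightarrow> nat) \<times> ((nat \<Rightarrow> real) \<Rightarrow> real) \<Rightarrow> real"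
  assumes kn: "k \<le> n" and f: "f \<in> bool_funs n"
    and \<tau>: "\<tau> = 1 / (12 * (real q)\<^sup>2)" and q: "2 * k \<le> q"
    and b: "b \<in> hash_space n m" and z: "z \<in> cube n"
    and pm: "pair_mass b \<le> \<tau>\<^sup>2 / 2"
    and aliasing: "(\<Sum>V\<in>Pow (heavy \<tau>). (alias_error b V z)\<^sup>2) \<le> (1 / q)\<^sup>2"
    and e0: "\<And>j. j < 2 * m \<Longrightarrow> \<bar>e0 j - flip_infl (bucket n (refine b z) j)\<bar> \<le> \<tau> / 2"
    and e1: "\<And>S h. (S, h) \<in> hypotheses k m \<Longrightarrow>
      \<bar>e1 (S, h) - avg (cube m \<times> noise_space n q)
         (\<lambda>(y, r). h (feature k m S y) * f (noisy n r (hashed_point n b z y)))\<bar> \<le> 1 / q"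
    and Acc: "Acc = {j. j < 2 * m \<and> 2 * \<tau> \<le> e0 j}"
    and cand: "(S, h) \<in> candidates k m Acc"
    and max: "\<And>c. c \<in> candidates k m Acc \<Longrightarrow> e1 c \<le> e1 (S, h)"
  shows "\<bar>e1 (S, h) - max_corr n k f\<bar> \<le> (3 * real k + 5) / q"
    and "\<exists>i\<in>coords n k. \<bar>max_corr n k f - corr n (\<lambda>x. h (fill k m S (proj k i x))) f\<bar> \<le> (3 * real k + 5) / q"
proof -
  have \<tau>0: "0 < \<tau>" using \<tau> q_pos by simp
  let ?c = "refine b z"
  have inj: "inj_on b (heavy \<tau>)"
  proof (rule inj_on_heavy[OF _ \<tau>0])
    have "0 < \<tau>\<^sup>2" using \<tau>0 by simp
    then show "pair_mass b < \<tau>\<^sup>2" using pm by linarith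
  qed
  have close: "\<bar>e1 (S, h) - corr n (\<lambda>x. h (fill k m S (proj k i x))) f\<bar> \<le> (real k + 2) / q"
    if "(S, h) \<in> hypotheses k m" "i \<in> coords n k"
      "\<And>j. j < k \<Longrightarrow> S j < 2 * m \<Longrightarrow> ?c (i j) = S j \<and> i j \<in> heavy \<tau>" for S h i
  proof -
    have "h \<in> bool_funs k" using that by (auto simp: hypotheses_def)
    from hypothesis_corr[OF that(2) this that(3) b z aliasing] e1[OF that(1)]
    have "\<bar>e1 (S, h) - corr n (\<lambda>x. h (fill k m S (proj k i x))) f\<bar> \<le> (real k + 1) / q + 1 / q"
      by linarith
    then show ?thesis by (simp add: add_divide_distrib)
  qed
  have hyp: "(S, h) \<in> hypotheses k m" and hb: "h \<in> bool_funs k"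
    and SAcc: "\<And>j. j < k \<Longrightarrow> S j < 2 * m \<Longrightarrow> S j \<in> Acc" and Sinj: "inj_on S {j. j < k \<and> S j < 2 * m}"
    using cand by (auto simp: candidates_def hypotheses_def)
  let ?J = "{j. j < k \<and> S j < 2 * m}"
  have "\<exists>a\<in>bucket n ?c (S j). a \<in> heavy \<tau>" if "j \<in> ?J" for j
  proof (rule heavy_in_bucket[OF _ _ pm \<tau>0])
    show "bucket n ?c (S j) \<subseteq> {..<n}" by (auto simp: bucket_def)
    show "b a = b a'" if "a \<in> bucket n ?c (S j)" "a' \<in> bucket n ?c (S j)" for a a'
      using bucket_same_hash that .
    have "S j < 2 * m" "2 * \<tau> \<le> e0 (S j)" using that SAcc[of j] Acc by auto
    then show "3 / 2 * \<tau> \<le> flip_infl (bucket n ?c (S j))" using e0[of "S j"] by linarith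
  qed
  \<comment> \<open>These coordinates exist for the analysis only; the algorithm never learns
    them.\<close>
  then obtain t where t: "\<And>j. j \<in> ?J \<Longrightarrow> t j \<in> bucket n ?c (S j) \<and> t j \<in> heavy \<tau>" by metis
  have tc: "?c (t j) = S j" "t j < n" if "j \<in> ?J" for j using t[OF that] by (auto simp: bucket_def)
  have tinj: "inj_on t ?J"
  proof (rule inj_onI)
    fix j j' assume J: "j \<in> ?J" "j' \<in> ?J" "t j = t j'"
    then have "S j = S j'" using tc(1)[OF J(1)] tc(1)[OF J(2)] by simp
    from inj_onD[OF Sinj this J(1,2)] show "j = j'" .
  qed
  have tn: "t ` ?J \<subseteq> {..<n}"
  proof
    fix a assume "a \<in> t ` ?J"
    then obtain j where "j \<in> ?J" "a = t j" by blast
    then show "a \<in> {..<n}" using tc(2)[of j] by simp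
  qed
  obtain i where i: "i \<in> coords n k" "\<And>j. j \<in> ?J \<Longrightarrow> i j = t j"
    using extend_coords[OF _ tinj tn kn] by (metis (no_types, lifting) lessThan_iff mem_Collect_eq subsetI)
  let ?corr = "corr n (\<lambda>x. h (fill k m S (proj k i x))) f"
  have c1: "\<bar>e1 (S, h) - ?corr\<bar> \<le> (real k + 2) / q"
  proof (rule close[OF hyp i(1)])
    fix j assume "j < k" "S j < 2 * m"
    then have j: "j \<in> ?J" by simp
    show "?c (i j) = S j \<and> i j \<in> heavy \<tau>" unfolding i(2)[OF j] using tc(1)[OF j] t[OF j] by simp
  qed
  have "?corr = corr n (\<lambda>x\<in>cube n. h (fill k m S (proj k i x))) f"
    unfolding corr_avg by (intro avg_cong) simp
  also have "\<dots> \<le> max_corr n k f" by (intro corr_le_max_corr junta_of_hypothesis i hb)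
  finally have c2: "?corr \<le> max_corr n k f" .
  have "max_corr n k f \<in> (\<lambda>l. corr n l f) ` juntas n k"
    unfolding max_corr_def using juntas_nonempty[OF kn] by (intro Max_in) (auto simp: finite_juntas)
  then obtain l where l: "l \<in> juntas n k" "max_corr n k f = corr n l f" by auto
  then obtain i' where i': "i' \<in> coords n k" and lb: "l \<in> bool_funs n"
    and dep: "\<forall>x\<in>cube n. \<forall>y\<in>cube n. (\<forall>j<k. x (i' j) = y (i' j)) \<longrightarrow> l x = l y"
    by (auto simp: juntas_def)
  have i'n: "i' j < n" if "j < k" for j using i' that by (auto simp: coords_def)
  \<comment> \<open>The level is 3 * \<tau>, not \<tau>, because only then is acceptance of the half
    bucket guaranteed.\<close>
  let ?J' = "{j. j < k \<and> 3 * \<tau> \<le> infl (i' j)}"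
  have cm: "?c a < 2 * m" if "a < n" for a
  proof -
    have "b a < m" using b that by (auto simp: hash_space_def)
    then show ?thesis by (auto simp: refine_def)
  qed
  define S' where "S' = (\<lambda>j\<in>{..<k}. if j \<in> ?J' then ?c (i' j) else 2 * m)"
  have S': "S' j < 2 * m \<longleftrightarrow> j \<in> ?J'" if "j < k" for j
    using that cm i'n by (auto simp: S'_def)
  have J'k: "?J' \<subseteq> {..<k}" by auto
  have J'light: "infl (i' j) \<le> 3 * \<tau>" if "j \<in> {..<k} - ?J'" for j using that by auto
  obtain h' where h': "h' \<in> bool_funs k"
    "corr n l f \<le> corr n (\<lambda>x. h' (fill k m S' (proj k i' x))) f + (real k + 1) / q"
    using light_junta[OF i' J'k lb dep J'light \<tau> q S'] by blast
  have hv: "i' j \<in> heavy \<tau>" if "j \<in> ?J'" for j using that i'n \<tau>0 by (auto simp: heavy_def)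
  have hyp': "(S', h') \<in> hypotheses k m"
    using h' cm i'n by (auto simp: hypotheses_def S'_def less_imp_le)
  have "(S', h') \<in> candidates k m Acc"
  proof -
    have "S' j \<in> Acc" if "j < k" "S' j < 2 * m" for j
    proof -
      have j: "j \<in> ?J'" using that S' by auto
      then have Sj: "S' j = ?c (i' j)" by (auto simp: S'_def)
      have "5 / 2 * \<tau> \<le> flip_infl (bucket n ?c (S' j))"
      proof (rule flip_infl_bucket[OF _ _ _ pm \<tau>0])
        show "bucket n ?c (S' j) \<subseteq> {..<n}" by (auto simp: bucket_def)
        show mem: "i' j \<in> bucket n ?c (S' j)" using j i'n Sj by (auto simp: bucket_def)
        show "b a = b (i' j)" if "a \<in> bucket n ?c (S' j)" for a using bucket_same_hash that mem .
        show "3 * \<tau> \<le> infl (i' j)" using j by auto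
      qed
      then have "2 * \<tau> \<le> e0 (S' j)" using e0[OF that(2)] by linarith
      then show ?thesis using that(2) unfolding Acc by simp
    qed
    \<comment> \<open>Equal half buckets mean equal hash values, and the hash separates heavy
      coordinates.\<close>
    moreover have "inj_on S' {j. j < k \<and> S' j < 2 * m}"
    proof (rule inj_onI)
      fix j j' assume dom: "j \<in> {j. j < k \<and> S' j < 2 * m}" "j' \<in> {j. j < k \<and> S' j < 2 * m}"
        and eq: "S' j = S' j'"
      have J: "j \<in> ?J'" using dom(1) S'[of j] by blast
      have J': "j' \<in> ?J'" using dom(2) S'[of j'] by blast
      have "?c (i' j) = ?c (i' j')" using eq J J' by (simp add: S'_def)
      then have "b (i' j) = b (i' j')"
        using bucket_same_hash[of "i' j" b z "?c (i' j)" "i' j'"] J J' i'n by (simp add: bucket_def)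
      from inj_onD[OF inj this hv[OF J] hv[OF J']] have "i' j = i' j'" .
      moreover have "inj_on i' {..<k}" using i' by (simp add: coords_def)
      ultimately show "j = j'" using J J' by (simp add: inj_on_def)
    qed
    ultimately show ?thesis using hyp' by (auto simp: candidates_def)
  qed
  then have "e1 (S', h') \<le> e1 (S, h)" by (rule max)
  moreover have "\<bar>e1 (S', h') - corr n (\<lambda>x. h' (fill k m S' (proj k i' x))) f\<bar> \<le> (real k + 2) / q"
  proof (rule close[OF hyp' i'])
    fix j assume "j < k" "S' j < 2 * m"
    then have "j \<in> ?J'" using S' by auto
    then show "?c (i' j) = S' j \<and> i' j \<in> heavy \<tau>" using hv by (auto simp: S'_def)
  qed
  ultimately have c3: "max_corr n k f \<le> e1 (S, h) + (real k + 2) / q + (real k + 1) / q"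
    using h'(2) l(2) by (simp add: add.commute)
  \<comment> \<open>Score error of either hypothesis, with the loss from dropped coordinates in
    between.\<close>
  have s1: "(3 * real k + 5) / q = (real k + 2) / q + (real k + 1) / q + (real k + 2) / q"
    by (simp flip: add_divide_distrib)
  have s2: "0 \<le> (real k + 2) / q" "0 \<le> (real k + 1) / q" by auto
  show "\<bar>e1 (S, h) - max_corr n k f\<bar> \<le> (3 * real k + 5) / q"
    using c1 c2 c3 s1 s2 by linarith
  have "\<bar>max_corr n k f - ?corr\<bar> \<le> (3 * real k + 5) / q"
    using c1 c2 c3 s1 s2 by linarith
  then show "\<exists>i\<in>coords n k. \<bar>max_corr n k f - corr n (\<lambda>x. h (fill k m S (proj k i x))) f\<bar> \<le> (3 * real k + 5) / q"
    using i(1) by auto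
qed

end

section \<open>The algorithm\<close>

definition flip_test :: "nat \<Rightarrow> ((nat \<Rightarrow> real) \<Rightarrow> real) \<Rightarrow> nat set \<Rightarrow>
    (nat \<Rightarrow> real) \<times> (nat \<Rightarrow> nat) \<times> (nat \<Rightarrow> nat) \<Rightarrow> real" where
  "flip_test n f B = (\<lambda>(x, r, r'). f (noisy n r x) * (f (noisy n r' x) - f (noisy n r' (flip n B x))) / 2)"

definition agreement :: "nat \<Rightarrow> nat \<Rightarrow> nat \<Rightarrow> (nat \<Rightarrow> nat) \<Rightarrow> (nat \<Rightarrow> real) \<Rightarrow> ((nat \<Rightarrow> real) \<Rightarrow> real) \<Rightarrow>
    (nat \<Rightarrow> nat) \<times> ((nat \<Rightarrow> real) \<Rightarrow> real) \<Rightarrow> (nat \<Rightarrow> real) \<times> (nat \<Rightarrow> nat) \<Rightarrow> real" where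
  "agreement n k m b z f c = (\<lambda>(y, r). snd c (feature k m (fst c) y) * f (noisy n r (hashed_point n b z y)))"

definition sample_mean :: "nat \<Rightarrow> (nat \<Rightarrow> 'a) \<Rightarrow> ('a \<Rightarrow> real) \<Rightarrow> real" where
  "sample_mean N \<omega> \<phi> = (\<Sum>l<N. \<phi> (\<omega> l)) / N"

definition accepted :: "nat \<Rightarrow> nat \<Rightarrow> real \<Rightarrow> nat \<Rightarrow> (nat \<Rightarrow> nat) \<Rightarrow> (nat \<Rightarrow> real) \<Rightarrow>
    (nat \<Rightarrow> (nat \<Rightarrow> real) \<times> (nat \<Rightarrow> nat) \<times> (nat \<Rightarrow> nat)) \<Rightarrow> ((nat \<Rightarrow> real) \<Rightarrow> real) \<Rightarrow> nat set" where
  "accepted n m \<tau> N b z \<omega> f =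
     {j. j < 2 * m \<and> 2 * \<tau> \<le> sample_mean N \<omega> (flip_test n f (bucket n (refine b z) j))}"

text \<open>\<open>fill\<close> is built into the returned function, so that it can be applied to
  projected points without reference to \<open>S\<close>.\<close>

definition learner_output :: "nat \<Rightarrow> nat \<Rightarrow> nat \<Rightarrow> real \<Rightarrow> nat \<Rightarrow> nat \<Rightarrow> (nat \<Rightarrow> nat) \<Rightarrow> (nat \<Rightarrow> real) \<Rightarrow>
    (nat \<Rightarrow> (nat \<Rightarrow> real) \<times> (nat \<Rightarrow> nat) \<times> (nat \<Rightarrow> nat)) \<Rightarrow> (nat \<Rightarrow> (nat \<Rightarrow> real) \<times> (nat \<Rightarrow> nat)) \<Rightarrow>
    ((nat \<Rightarrow> real) \<Rightarrow> real) \<Rightarrow> real \<times> ((nat \<Rightarrow> real) \<Rightarrow> real)" where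
  "learner_output n k m \<tau> N0 N1 b z \<omega> \<eta> f =
     (let e = (\<lambda>c. sample_mean N1 \<eta> (agreement n k m b z f c));
          c = arg_min_on (\<lambda>c. - e c) (candidates k m (accepted n m \<tau> N0 b z \<omega> f))
      in (e c, \<lambda>x\<in>cube k. snd c (fill k m (fst c) x)))"

text \<open>One sample tests all 2 * m half buckets at once; its two unflipped points are
  shared.\<close>

definition flip_queries :: "nat \<Rightarrow> nat \<Rightarrow> (nat \<Rightarrow> nat) \<Rightarrow> (nat \<Rightarrow> real) \<Rightarrow>
    (nat \<Rightarrow> real) \<times> (nat \<Rightarrow> nat) \<times> (nat \<Rightarrow> nat) \<Rightarrow> (nat \<Rightarrow> real) list" where
  "flip_queries n m b z = (\<lambda>(x, r, r'). noisy n r x # noisy n r' x #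
     map (\<lambda>j. noisy n r' (flip n (bucket n (refine b z) j) x)) [0..<2 * m])"

definition learner_queries :: "nat \<Rightarrow> nat \<Rightarrow> nat \<Rightarrow> nat \<Rightarrow> (nat \<Rightarrow> nat) \<Rightarrow> (nat \<Rightarrow> real) \<Rightarrow>
    (nat \<Rightarrow> (nat \<Rightarrow> real) \<times> (nat \<Rightarrow> nat) \<times> (nat \<Rightarrow> nat)) \<Rightarrow> (nat \<Rightarrow> (nat \<Rightarrow> real) \<times> (nat \<Rightarrow> nat)) \<Rightarrow>
    (nat \<Rightarrow> real) list" where
  "learner_queries n m N0 N1 b z \<omega> \<eta> =
     concat (map (\<lambda>l. flip_queries n m b z (\<omega> l)) [0..<N0]) @
     map (\<lambda>l. case \<eta> l of (y, r) \<Rightarrow> noisy n r (hashed_point n b z y)) [0..<N1]"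

definition learner_tree where
  "learner_tree n k m \<tau> N0 N1 b z \<omega> \<eta> =
     query_tree (learner_queries n m N0 N1 b z \<omega> \<eta>) (learner_output n k m \<tau> N0 N1 b z \<omega> \<eta>) (\<lambda>_. 1)"

definition learner where
  "learner n k q m \<tau> N0 N1 =
     bind_pmf (pmf_of_set (hash_space n m)) (\<lambda>b.
     bind_pmf (pmf_of_set (cube n)) (\<lambda>z.
     bind_pmf (Pi_pmf {..<N0} undefined (\<lambda>_. pmf_of_set (cube n \<times> noise_space n q \<times> noise_space n q))) (\<lambda>\<omega>.
     bind_pmf (Pi_pmf {..<N1} undefined (\<lambda>_. pmf_of_set (cube m \<times> noise_space n q))) (\<lambda>\<eta>.
     return_pmf (learner_tree n k m \<tau> N0 N1 b z \<omega> \<eta>)))))"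

text \<open>Makes the default answer 1 in \<open>learner_tree\<close> harmless: the output reads the
  oracle at listed points only.\<close>

lemma learner_output_cong:
  assumes "\<And>x. x \<in> set (learner_queries n m N0 N1 b z \<omega> \<eta>) \<Longrightarrow> f x = g x"
  shows "learner_output n k m \<tau> N0 N1 b z \<omega> \<eta> f = learner_output n k m \<tau> N0 N1 b z \<omega> \<eta> g"
proof -
  have "sample_mean N1 \<eta> (agreement n k m b z f c) = sample_mean N1 \<eta> (agreement n k m b z g c)" for c
  proof -
    have "agreement n k m b z f c (\<eta> l) = agreement n k m b z g c (\<eta> l)" if "l < N1" for l
    proof -
      obtain y r where yr: "\<eta> l = (y, r)" by fastforce
      have "noisy n r (hashed_point n b z y) \<in> set (learner_queries n m N0 N1 b z \<omega> \<eta>)"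
        unfolding learner_queries_def using that yr by (auto intro!: image_eqI[of _ _ l])
      then show ?thesis using assms by (simp add: agreement_def yr)
    qed
    then show ?thesis by (simp add: sample_mean_def)
  qed
  moreover have "sample_mean N0 \<omega> (flip_test n f (bucket n (refine b z) j))
     = sample_mean N0 \<omega> (flip_test n g (bucket n (refine b z) j))" if j: "j < 2 * m" for j
  proof -
    have "flip_test n f (bucket n (refine b z) j) (\<omega> l) = flip_test n g (bucket n (refine b z) j) (\<omega> l)"
      if "l < N0" for l
    proof -
      obtain x r r' where xr: "\<omega> l = (x, r, r')" by (metis prod_cases3)
      have "set (flip_queries n m b z (\<omega> l)) \<subseteq> set (learner_queries n m N0 N1 b z \<omega> \<eta>)"
        unfolding learner_queries_def using that by auto
      moreover have "{noisy n r x, noisy n r' x, noisy n r' (flip n (bucket n (refine b z) j) x)}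
          \<subseteq> set (flip_queries n m b z (\<omega> l))"
        using j by (auto simp: flip_queries_def xr)
      ultimately show ?thesis using assms by (simp add: flip_test_def xr subset_iff)
    qed
    then show ?thesis by (simp add: sample_mean_def)
  qed
  then have "accepted n m \<tau> N0 b z \<omega> f = accepted n m \<tau> N0 b z \<omega> g"
    by (auto simp: accepted_def)
  ultimately show ?thesis by (simp add: learner_output_def)
qed

lemma length_learner_queries:
  "length (learner_queries n m N0 N1 b z \<omega> \<eta>) = N0 * (2 * m + 2) + N1"
proof -
  have "length (flip_queries n m b z s) = 2 * m + 2" for s
    by (cases s) (simp add: flip_queries_def)
  then show ?thesis
    by (simp add: learner_queries_def length_concat o_def sum_list_triv)
qed

lemma learner_queries_in_cube:
  assumes "b \<in> hash_space n m" "z \<in> cube n"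
    and "\<And>l. l < N0 \<Longrightarrow> \<omega> l \<in> cube n \<times> noise_space n q \<times> noise_space n q"
    and "\<And>l. l < N1 \<Longrightarrow> \<eta> l \<in> cube m \<times> noise_space n q"
  shows "set (learner_queries n m N0 N1 b z \<omega> \<eta>) \<subseteq> cube n"
proof -
  have "set (flip_queries n m b z (\<omega> l)) \<subseteq> cube n" if "l < N0" for l
    using assms(3)[OF that] by (auto simp: flip_queries_def noisy_in_cube flip_in_cube)
  moreover have "(case \<eta> l of (y, r) \<Rightarrow> noisy n r (hashed_point n b z y)) \<in> cube n" if "l < N1" for l
  proof -
    obtain y r where yr: "\<eta> l = (y, r)" by fastforce
    then have "y \<in> cube m" using assms(4)[OF that] by simp
    from noisy_in_cube[OF hashed_point_in_cube[OF assms(1)[unfolded hash_space_def] assms(2) this]]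
    show ?thesis by (simp add: yr)
  qed
  ultimately show ?thesis
    by (simp add: learner_queries_def UN_subset_iff image_subset_iff)
qed

lemma finite_hypotheses: "finite (hypotheses k m)"
  by (simp add: hypotheses_def bool_funs_def finite_PiE finite_cube)

lemma card_hypotheses: "card (hypotheses k m) = (2 * m + 1) ^ k * 2 ^ 2 ^ k"
  by (simp add: hypotheses_def bool_funs_def card_cartesian_product card_PiE finite_cube card_cube numeral_2_eq_2)

lemma candidates_nonempty: "candidates k m Acc \<noteq> {}"
proof -
  have "((\<lambda>j\<in>{..<k}. 2 * m), (\<lambda>x\<in>cube k. 1)) \<in> candidates k m Acc"
    by (auto simp: candidates_def hypotheses_def bool_funs_def inj_on_def)
  then show ?thesis by blast
qed

lemma finite_candidates: "finite (candidates k m Acc)"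
  by (rule finite_subset[OF _ finite_hypotheses[of k m]]) (auto simp: candidates_def)

lemma feature_in_cube:
  assumes "y \<in> cube m"
  shows "feature k m S y \<in> cube k"
proof -
  have "bucket_value y (S j) \<in> {-1, 1}" if "S j < 2 * m" for j
    using cube_values[OF assms, of "S j div 2"] that by (auto simp: bucket_value_def)
  then show ?thesis unfolding feature_def cube_def by (intro restrict_PiE_iff[THEN iffD2]) auto
qed

lemma set_Pi_pmf_uniform:
  fixes N :: nat
  assumes "\<omega> \<in> set_pmf (Pi_pmf {..<N} d (\<lambda>_. pmf_of_set \<Omega>))" "finite \<Omega>" "\<Omega> \<noteq> {}" "l < N"
  shows "\<omega> l \<in> \<Omega>"
  using assms by (auto simp: set_Pi_pmf PiE_dflt_def)

section \<open>Failure probabilities and success of the algorithm\<close>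

context noisy_oracle
begin

text \<open>Markov: the mean is at most 2 * q^2 / m and the level is 1 / (288 * q^4), so the bound
  576 * q^6 / m equals 1 / 12 for this \<open>m\<close>.\<close>

lemma prob_bad_hash:
  assumes \<tau>: "\<tau> = 1 / (12 * (real q)\<^sup>2)" and m: "m = 6912 * q ^ 6"
  shows "measure_pmf.prob (pmf_of_set (hash_space n m)) {b. \<tau>\<^sup>2 / 2 < collisions b + pair_mass b} \<le> 1 / 12"
proof -
  have m1: "1 \<le> m" using q_pos m by (simp add: Suc_le_eq)
  have q0: "0 < real q" using q_pos by simp
  have "measure_pmf.prob (pmf_of_set (hash_space n m)) {b. \<tau>\<^sup>2 / 2 < collisions b + pair_mass b}
      \<le> avg (hash_space n m) (\<lambda>b. collisions b + pair_mass b) / (\<tau>\<^sup>2 / 2)"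
    using m1 q_pos by (intro markov_uniform)
      (auto simp: finite_hash_space hash_space_nonempty collisions_nonneg pair_mass_nonneg \<tau>)
  also have "\<dots> \<le> ((real q)\<^sup>2 / m + (real q)\<^sup>2 / m) / (\<tau>\<^sup>2 / 2)"
    using avg_collisions[OF m1] avg_pair_mass[OF m1] by (intro divide_right_mono) (auto simp: avg_add)
  also have "\<dots> = 1 / 12"
  proof -
    define w where "w = (real q)\<^sup>2"
    have w: "0 < w" "real m = 6912 * w ^ 3" using q0 by (simp_all add: w_def m flip: power_mult)
    then show ?thesis unfolding \<tau> w_def[symmetric] w(2) by (simp add: field_simps power2_eq_square power3_eq_cube)
  qed
  finally show ?thesis .
qed

lemma prob_bad_shift:
  assumes \<tau>: "\<tau> = 1 / (12 * (real q)\<^sup>2)" and b: "collisions b + pair_mass b \<le> \<tau>\<^sup>2 / 2"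
  shows "measure_pmf.prob (pmf_of_set (cube n))
     {z. (1 / q)\<^sup>2 < (\<Sum>V\<in>Pow (heavy \<tau>). (alias_error b V z)\<^sup>2)} \<le> 1 / 12"
proof -
  have q0: "0 < real q" using q_pos by simp
  have \<tau>0: "0 < \<tau>" "\<tau> \<le> 1" using q0 q_pos by (auto simp: \<tau> field_simps) (use one_le_power[of "real q" 2] in linarith)
  have "0 < \<tau>\<^sup>2" using \<tau>0 by simp
  then have "pair_mass b < \<tau>\<^sup>2" using b collisions_nonneg[of b] by linarith
  then have inj: "inj_on b (heavy \<tau>)" using \<tau>0 by (intro inj_on_heavy)
  have "measure_pmf.prob (pmf_of_set (cube n))
     {z. (1 / q)\<^sup>2 < (\<Sum>V\<in>Pow (heavy \<tau>). (alias_error b V z)\<^sup>2)}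
     \<le> avg (cube n) (\<lambda>z. \<Sum>V\<in>Pow (heavy \<tau>). (alias_error b V z)\<^sup>2) / (1 / q)\<^sup>2"
    using q0 by (intro markov_uniform) (auto simp: finite_cube cube_nonempty sum_nonneg)
  also have "\<dots> \<le> (\<tau> / 2) / (1 / q)\<^sup>2"
  proof (intro divide_right_mono)
    have "avg (cube n) (\<lambda>z. \<Sum>V\<in>Pow (heavy \<tau>). (alias_error b V z)\<^sup>2) \<le> collisions b + pair_mass b / \<tau>"
      using inj \<tau>0 by (intro avg_alias_error_heavy)
    \<comment> \<open>Since \<tau> \<le> 1, both error terms can share the denominator, and one
      threshold on their sum suffices.\<close>
    also have "collisions b \<le> collisions b / \<tau>"
      using \<tau>0 collisions_nonneg[of b] by (simp add: le_divide_eq mult_left_le)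
    finally have "avg (cube n) (\<lambda>z. \<Sum>V\<in>Pow (heavy \<tau>). (alias_error b V z)\<^sup>2) \<le> (collisions b + pair_mass b) / \<tau>"
      by (simp add: add_divide_distrib)
    also have "\<dots> \<le> (\<tau>\<^sup>2 / 2) / \<tau>" using b \<tau>0 by (intro divide_right_mono) auto
    also have "\<dots> = \<tau> / 2" using \<tau>0 by (simp add: power2_eq_square)
    finally show "avg (cube n) (\<lambda>z. \<Sum>V\<in>Pow (heavy \<tau>). (alias_error b V z)\<^sup>2) \<le> \<tau> / 2" .
  qed simp
  also have "\<dots> \<le> 1 / 12" using q0 by (simp add: \<tau> power2_eq_square)
  finally show ?thesis .
qed

text \<open>\<open>N\<close> makes the Hoeffding exponent 48 * m at deviation \<tau> / 2; the union
  over 2 * m half buckets then costs 4 * m * exp (- 48 * m), at most 1 / 12.\<close>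

lemma prob_bad_flip_tests:
  assumes \<tau>: "\<tau> = 1 / (12 * (real q)\<^sup>2)" and m: "1 \<le> m" and N: "N = 55296 * q ^ 4 * m"
  shows "measure_pmf.prob (Pi_pmf {..<N} d (\<lambda>_. pmf_of_set (cube n \<times> noise_space n q \<times> noise_space n q)))
     {\<omega>. \<exists>j\<in>{..<2 * m}. \<tau> / 2 \<le> \<bar>sample_mean N \<omega> (flip_test n f (bucket n c j)) - flip_infl (bucket n c j)\<bar>}
     \<le> 1 / 12"
proof -
  let ?\<Omega> = "cube n \<times> noise_space n q \<times> noise_space n q"
  have q0: "0 < real q" using q_pos by simp
  have N0: "0 < N" using N m q_pos by simp
  have bound: "\<bar>flip_test n f B a\<bar> \<le> 1" if "a \<in> ?\<Omega>" for B a
  proof -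
    obtain x r r' where a: "a = (x, r, r')" by (metis prod_cases3)
    then have "x \<in> cube n" using that by simp
    then have "f (noisy n r x) = 1 \<or> f (noisy n r x) = -1" "f (noisy n r' x) = 1 \<or> f (noisy n r' x) = -1"
      "f (noisy n r' (flip n B x)) = 1 \<or> f (noisy n r' (flip n B x)) = -1"
      by (auto intro!: f_bool noisy_in_cube flip_in_cube)
    then show ?thesis by (auto simp: flip_test_def a)
  qed
  have "avg ?\<Omega> (flip_test n f B) = flip_infl B" for B
    unfolding flip_test_def by (rule avg_flip_test)
  then have "measure_pmf.prob (Pi_pmf {..<N} d (\<lambda>_. pmf_of_set ?\<Omega>))
     {\<omega>. \<exists>j\<in>{..<2 * m}. \<tau> / 2 \<le> \<bar>sample_mean N \<omega> (flip_test n f (bucket n c j)) - flip_infl (bucket n c j)\<bar>}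
     \<le> card {..<2 * m} * (2 * exp (- (real N * (\<tau> / 2)\<^sup>2 / 2)))"
    using uniform_convergence[of ?\<Omega> N "\<tau> / 2" "{..<2 * m}" "\<lambda>j. flip_test n f (bucket n c j)" d] bound N0 q_pos
    by (simp add: sample_mean_def finite_cube cube_nonempty finite_noise_space noise_space_nonempty \<tau>)
  also have "real N * (\<tau> / 2)\<^sup>2 / 2 = 48 * real m"
  proof -
    define w where "w = (real q)\<^sup>2"
    have w: "0 < w" "real N = 55296 * w\<^sup>2 * m" using q0 by (simp_all add: w_def N flip: power_mult)
    then show ?thesis unfolding \<tau> w_def[symmetric] w(2) by (simp add: field_simps power2_eq_square)
  qed
  also have "card {..<2 * m} * (2 * exp (- (48 * real m))) \<le> 1 / 12"
  proof -
    have "48 * real m \<le> exp (48 * real m)" using exp_ge_add_one_self[of "48 * real m"] by linarith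
    then show ?thesis by (simp add: exp_minus field_simps)
  qed
  finally show ?thesis .
qed

text \<open>The three summands of \<open>N\<close> offset in turn the choices of \<open>S\<close>,
  the choices of \<open>h\<close> and the remaining factor 2 down to 1 / 12. Even the crude bound 2
  * m + 1 \<le> exp (2 * m) leaves a polynomial cost for \<open>S\<close>.\<close>

lemma prob_bad_agreements:
  assumes b: "b \<in> hash_space n m" and z: "z \<in> cube n" and N: "N = 2 * q ^ 2 * (2 * m * k + 2 ^ k + 24)"
  shows "measure_pmf.prob (Pi_pmf {..<N} d (\<lambda>_. pmf_of_set (cube m \<times> noise_space n q)))
     {\<eta>. \<exists>c\<in>hypotheses k m. 1 / q \<le> \<bar>sample_mean N \<eta> (agreement n k m b z f c)
        - avg (cube m \<times> noise_space n q) (agreement n k m b z f c)\<bar>} \<le> 1 / 12"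
proof -
  let ?\<Omega> = "cube m \<times> noise_space n q"
  have q0: "0 < real q" using q_pos by simp
  have N0: "0 < N" using N q_pos by simp
  have bound: "\<bar>agreement n k m b z f c a\<bar> \<le> 1" if "a \<in> ?\<Omega>" "c \<in> hypotheses k m" for c a
  proof -
    obtain y r S h where a: "a = (y, r)" "c = (S, h)" by fastforce
    then have "y \<in> cube m" "h \<in> bool_funs k" using that by (auto simp: hypotheses_def)
    then have "h (feature k m S y) = 1 \<or> h (feature k m S y) = -1"
      "f (noisy n r (hashed_point n b z y)) = 1 \<or> f (noisy n r (hashed_point n b z y)) = -1"
      using bool_funs_values[OF _ feature_in_cube]
        f_bool[OF noisy_in_cube[OF hashed_point_in_cube[OF b[unfolded hash_space_def] z]]] by blast+
    then show ?thesis by (auto simp: agreement_def a)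
  qed
  have "measure_pmf.prob (Pi_pmf {..<N} d (\<lambda>_. pmf_of_set ?\<Omega>))
     {\<eta>. \<exists>c\<in>hypotheses k m. 1 / q \<le> \<bar>sample_mean N \<eta> (agreement n k m b z f c)
        - avg ?\<Omega> (agreement n k m b z f c)\<bar>}
     \<le> card (hypotheses k m) * (2 * exp (- (real N * (1 / q)\<^sup>2 / 2)))"
    unfolding sample_mean_def using bound N0 q_pos
    by (intro uniform_convergence)
       (auto simp: finite_cube cube_nonempty finite_noise_space noise_space_nonempty finite_hypotheses)
  also have "real N * (1 / q)\<^sup>2 / 2 = 2 * real m * k + 2 ^ k + 24"
    using q0 by (simp add: N field_simps power2_eq_square)
  also have "card (hypotheses k m) * (2 * exp (- (2 * real m * k + 2 ^ k + 24))) \<le> 1 / 12"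
  proof -
    have "(2 * real m + 1) ^ k \<le> exp (2 * real m) ^ k"
      using exp_ge_add_one_self[of "2 * real m"] by (intro power_mono) linarith+
    also have "\<dots> = exp (2 * real m * k)" by (simp add: mult.commute flip: exp_of_nat_mult)
    finally have 1: "(2 * real m + 1) ^ k \<le> exp (2 * real m * k)" .
    have "(2::real) ^ 2 ^ k \<le> exp 1 ^ 2 ^ k"
      using exp_ge_add_one_self[of 1] by (intro power_mono) auto
    also have "\<dots> = exp (2 ^ k)" by (simp flip: exp_of_nat_mult)
    finally have 2: "(2::real) ^ 2 ^ k \<le> exp (2 ^ k)" .
    have 3: "24 \<le> exp (24::real)" using exp_ge_add_one_self[of 24] by simp
    have "(2 * real m + 1) ^ k * 2 ^ 2 ^ k * 24 \<le> exp (2 * real m * k) * exp (2 ^ k) * exp 24"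
      using 1 2 3 by (intro mult_mono) auto
    then have le: "(2 * real m + 1) ^ k * 2 ^ 2 ^ k * 24 \<le> exp (2 * real m * k + 2 ^ k + 24)"
      by (simp only: exp_add)
    have div: "a * (2 * inverse E) \<le> 1 / 12" if "a * 24 \<le> E" "0 < E" for a E :: real
      using that by (simp add: field_simps)
    show ?thesis
      using div[OF le exp_gt_zero] unfolding card_hypotheses exp_minus by (simp add: add.commute[of 1])
  qed
  finally show ?thesis .
qed

definition success :: "nat \<Rightarrow> real \<Rightarrow> real \<times> ((nat \<Rightarrow> real) \<Rightarrow> real) \<Rightarrow> bool" where
  "success k \<epsilon> = (\<lambda>(c, h). h \<in> bool_funs k \<and> \<bar>c - max_corr n k f\<bar> \<le> \<epsilon> \<and>
     (\<exists>i\<in>coords n k. \<bar>max_corr n k f - corr n (\<lambda>x. h (proj k i x)) f\<bar> \<le> \<epsilon>))"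

lemma learner_output_success:
  assumes kn: "k \<le> n" and f: "f \<in> bool_funs n"
    and \<tau>: "\<tau> = 1 / (12 * (real q)\<^sup>2)" and q: "2 * k \<le> q" "(3 * real k + 5) / q \<le> \<epsilon>"
    and b: "b \<in> hash_space n m" and z: "z \<in> cube n"
    and pm: "collisions b + pair_mass b \<le> \<tau>\<^sup>2 / 2"
    and aliasing: "(\<Sum>V\<in>Pow (heavy \<tau>). (alias_error b V z)\<^sup>2) \<le> (1 / q)\<^sup>2"
    and e0: "\<And>j. j < 2 * m \<Longrightarrow> \<bar>sample_mean N0 \<omega> (flip_test n f (bucket n (refine b z) j))
               - flip_infl (bucket n (refine b z) j)\<bar> \<le> \<tau> / 2"
    and e1: "\<And>c. c \<in> hypotheses k m \<Longrightarrow> \<bar>sample_mean N1 \<eta> (agreement n k m b z f c)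
               - avg (cube m \<times> noise_space n q) (agreement n k m b z f c)\<bar> \<le> 1 / q"
  shows "success k \<epsilon> (learner_output n k m \<tau> N0 N1 b z \<omega> \<eta> f)"
proof -
  let ?e0 = "\<lambda>j. sample_mean N0 \<omega> (flip_test n f (bucket n (refine b z) j))"
  let ?e1 = "\<lambda>c. sample_mean N1 \<eta> (agreement n k m b z f c)"
  let ?Acc = "accepted n m \<tau> N0 b z \<omega> f"
  have Acc: "?Acc = {j. j < 2 * m \<and> 2 * \<tau> \<le> ?e0 j}" by (simp add: accepted_def)
  obtain S h where c: "arg_min_on (\<lambda>c. - ?e1 c) (candidates k m ?Acc) = (S, h)" by fastforce
  have cand: "(S, h) \<in> candidates k m ?Acc"
    using arg_min_if_finite(1)[OF finite_candidates candidates_nonempty, where f = "\<lambda>c. - ?e1 c"] c by metis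
  have opt: "?e1 c' \<le> ?e1 (S, h)" if "c' \<in> candidates k m ?Acc" for c'
    using arg_min_if_finite(2)[OF finite_candidates candidates_nonempty, where f = "\<lambda>c. - ?e1 c"] c that
    by (metis neg_less_iff_less not_le)
  have pm': "pair_mass b \<le> \<tau>\<^sup>2 / 2" using pm collisions_nonneg[of b] by linarith
  have e1': "\<bar>?e1 (S, h) - avg (cube m \<times> noise_space n q)
      (\<lambda>(y, r). h (feature k m S y) * f (noisy n r (hashed_point n b z y)))\<bar> \<le> 1 / q"
    if "(S, h) \<in> hypotheses k m" for S h
    using e1[OF that] by (simp add: agreement_def)
  note correct = maximiser_correct[OF kn f \<tau> q(1) b z pm' aliasing e0 e1' Acc cand opt]
  have hb: "h \<in> bool_funs k" using cand by (auto simp: candidates_def hypotheses_def)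
  let ?h = "\<lambda>x\<in>cube k. h (fill k m S x)"
  have out: "learner_output n k m \<tau> N0 N1 b z \<omega> \<eta> f = (?e1 (S, h), ?h)"
    by (simp add: learner_output_def Let_def c)
  have "?h \<in> bool_funs k"
    using bool_funs_values[OF hb fill_in_cube] by (auto simp: bool_funs_def)
  moreover have "corr n (\<lambda>x. ?h (proj k i x)) f = corr n (\<lambda>x. h (fill k m S (proj k i x))) f" if "i \<in> coords n k" for i
    unfolding corr_avg using proj_in_cube[OF that] by (intro avg_cong) simp
  then have "\<exists>i\<in>coords n k. \<bar>max_corr n k f - corr n (\<lambda>x. ?h (proj k i x)) f\<bar> \<le> \<epsilon>"
    using correct(2) q(2) by (metis order_trans)
  moreover have "\<bar>?e1 (S, h) - max_corr n k f\<bar> \<le> \<epsilon>" using correct(1) q(2) by linarith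
  ultimately show ?thesis by (simp add: success_def out)
qed

text \<open>The four choices are peeled off in order, since the bound for the shift presupposes a
  good hash. With all of them good, success is certain.\<close>

lemma prob_learner_failure:
  assumes kn: "k \<le> n" and f: "f \<in> bool_funs n"
    and \<tau>: "\<tau> = 1 / (12 * (real q)\<^sup>2)" and q: "2 * k \<le> q" "(3 * real k + 5) / q \<le> \<epsilon>"
    and m: "m = 6912 * q ^ 6" and N0: "N0 = 55296 * q ^ 4 * m" and N1: "N1 = 2 * q ^ 2 * (2 * m * k + 2 ^ k + 24)"
  shows "measure_pmf.prob (learner n k q m \<tau> N0 N1) {t. \<not> success k \<epsilon> (run f t)} \<le> 1 / 3"
proof -
  let ?E = "{t. \<not> success k \<epsilon> (run f t)}"
  let ?\<Omega>0 = "cube n \<times> noise_space n q \<times> noise_space n q" and ?\<Omega>1 = "cube m \<times> noise_space n q"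
  let ?P0 = "Pi_pmf {..<N0} undefined (\<lambda>_. pmf_of_set ?\<Omega>0)" and ?P1 = "Pi_pmf {..<N1} undefined (\<lambda>_. pmf_of_set ?\<Omega>1)"
  have m1: "1 \<le> m" using m q_pos by (simp add: Suc_le_eq)
  have fin: "finite ?\<Omega>0" "?\<Omega>0 \<noteq> {}" "finite ?\<Omega>1" "?\<Omega>1 \<noteq> {}"
    using q_pos by (auto simp: finite_cube cube_nonempty finite_noise_space noise_space_nonempty)
  have "measure_pmf.prob (learner n k q m \<tau> N0 N1) ?E \<le> 1 / 12 + 3 / 12"
    unfolding learner_def
  proof (rule prob_bind_le[OF prob_bad_hash[OF \<tau> m]])
    fix b assume "b \<in> set_pmf (pmf_of_set (hash_space n m))" "b \<notin> {b. \<tau>\<^sup>2 / 2 < collisions b + pair_mass b}"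
    then have b: "b \<in> hash_space n m" and pm: "collisions b + pair_mass b \<le> \<tau>\<^sup>2 / 2"
      using m1 by (auto simp: finite_hash_space hash_space_nonempty)
    have "measure_pmf.prob (bind_pmf (pmf_of_set (cube n)) (\<lambda>z. bind_pmf ?P0 (\<lambda>\<omega>. bind_pmf ?P1 (\<lambda>\<eta>.
        return_pmf (learner_tree n k m \<tau> N0 N1 b z \<omega> \<eta>))))) ?E \<le> 1 / 12 + 2 / 12"
    proof (rule prob_bind_le[OF prob_bad_shift[OF \<tau> pm]])
      fix z assume "z \<in> set_pmf (pmf_of_set (cube n))"
        "z \<notin> {z. (1 / q)\<^sup>2 < (\<Sum>V\<in>Pow (heavy \<tau>). (alias_error b V z)\<^sup>2)}"
      then have z: "z \<in> cube n" and al: "(\<Sum>V\<in>Pow (heavy \<tau>). (alias_error b V z)\<^sup>2) \<le> (1 / q)\<^sup>2"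
        by (auto simp: finite_cube cube_nonempty)
      have "measure_pmf.prob (bind_pmf ?P0 (\<lambda>\<omega>. bind_pmf ?P1 (\<lambda>\<eta>.
        return_pmf (learner_tree n k m \<tau> N0 N1 b z \<omega> \<eta>)))) ?E \<le> 1 / 12 + 1 / 12"
      proof (rule prob_bind_le[OF prob_bad_flip_tests[OF \<tau> m1 N0, where c = "refine b z"]])
        fix \<omega> assume \<omega>: "\<omega> \<in> set_pmf ?P0" and \<omega>': "\<omega> \<notin> {\<omega>. \<exists>j\<in>{..<2 * m}. \<tau> / 2 \<le>
          \<bar>sample_mean N0 \<omega> (flip_test n f (bucket n (refine b z) j)) - flip_infl (bucket n (refine b z) j)\<bar>}"
        have "measure_pmf.prob (bind_pmf ?P1 (\<lambda>\<eta>. return_pmf (learner_tree n k m \<tau> N0 N1 b z \<omega> \<eta>))) ?E \<le> 1 / 12 + 0"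
        proof (rule prob_bind_le[OF prob_bad_agreements[OF b z N1]])
          fix \<eta> assume \<eta>: "\<eta> \<in> set_pmf ?P1" and \<eta>': "\<eta> \<notin> {\<eta>. \<exists>c\<in>hypotheses k m. 1 / q \<le>
            \<bar>sample_mean N1 \<eta> (agreement n k m b z f c) - avg ?\<Omega>1 (agreement n k m b z f c)\<bar>}"
          let ?Q = "learner_queries n m N0 N1 b z \<omega> \<eta>"
          have "set ?Q \<subseteq> cube n"
            using set_Pi_pmf_uniform[OF \<omega> fin(1,2)] set_Pi_pmf_uniform[OF \<eta> fin(3,4)]
            by (intro learner_queries_in_cube[OF b z]) auto
          then have "run f (learner_tree n k m \<tau> N0 N1 b z \<omega> \<eta>)
              = learner_output n k m \<tau> N0 N1 b z \<omega> \<eta> (\<lambda>x. if x \<in> set ?Q then f x else 1)"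
            unfolding learner_tree_def using f_bool by (intro run_query_tree) auto
          also have "\<dots> = learner_output n k m \<tau> N0 N1 b z \<omega> \<eta> f"
            by (rule learner_output_cong) simp
          finally have run: "run f (learner_tree n k m \<tau> N0 N1 b z \<omega> \<eta>) = learner_output n k m \<tau> N0 N1 b z \<omega> \<eta> f" .
          have "success k \<epsilon> (learner_output n k m \<tau> N0 N1 b z \<omega> \<eta> f)"
          proof (rule learner_output_success[OF kn f \<tau> q b z pm al])
            show "\<bar>sample_mean N0 \<omega> (flip_test n f (bucket n (refine b z) j)) - flip_infl (bucket n (refine b z) j)\<bar> \<le> \<tau> / 2"
              if "j < 2 * m" for j using \<omega>' that by force
            show "\<bar>sample_mean N1 \<eta> (agreement n k m b z f c) - avg ?\<Omega>1 (agreement n k m b z f c)\<bar> \<le> 1 / q"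
              if "c \<in> hypotheses k m" for c using \<eta>' that by force
          qed
          then show "measure_pmf.prob (return_pmf (learner_tree n k m \<tau> N0 N1 b z \<omega> \<eta>)) ?E \<le> 0"
            by (simp add: run)
        qed simp
        then show "measure_pmf.prob (bind_pmf ?P1 (\<lambda>\<eta>. return_pmf (learner_tree n k m \<tau> N0 N1 b z \<omega> \<eta>))) ?E \<le> 1 / 12"
          by simp
      qed simp
      then show "measure_pmf.prob (bind_pmf ?P0 (\<lambda>\<omega>. bind_pmf ?P1 (\<lambda>\<eta>.
        return_pmf (learner_tree n k m \<tau> N0 N1 b z \<omega> \<eta>)))) ?E \<le> 2 / 12" by simp
    qed simp
    then show "measure_pmf.prob (bind_pmf (pmf_of_set (cube n)) (\<lambda>z. bind_pmf ?P0 (\<lambda>\<omega>. bind_pmf ?P1 (\<lambda>\<eta>.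
        return_pmf (learner_tree n k m \<tau> N0 N1 b z \<omega> \<eta>))))) ?E \<le> 3 / 12" by simp
  qed simp
  then show ?thesis by simp
qed

end

section \<open>Query count and choice of parameters\<close>

lemma learner_support:
  assumes "t \<in> set_pmf (learner n k q m \<tau> N0 N1)" "1 \<le> q" "1 \<le> m"
  shows "query_points t \<subseteq> cube n" "num_queries f t = N0 * (2 * m + 2) + N1"
proof -
  let ?\<Omega>0 = "cube n \<times> noise_space n q \<times> noise_space n q" and ?\<Omega>1 = "cube m \<times> noise_space n q"
  have fin: "finite ?\<Omega>0" "?\<Omega>0 \<noteq> {}" "finite ?\<Omega>1" "?\<Omega>1 \<noteq> {}"
    using assms by (auto simp: finite_cube cube_nonempty finite_noise_space noise_space_nonempty)
  obtain b z \<omega> \<eta> where *: "b \<in> hash_space n m" "z \<in> cube n"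
    "\<omega> \<in> set_pmf (Pi_pmf {..<N0} undefined (\<lambda>_. pmf_of_set ?\<Omega>0))"
    "\<eta> \<in> set_pmf (Pi_pmf {..<N1} undefined (\<lambda>_. pmf_of_set ?\<Omega>1))"
    and t: "t = learner_tree n k m \<tau> N0 N1 b z \<omega> \<eta>"
    using assms unfolding learner_def
    by (auto simp: finite_hash_space hash_space_nonempty finite_cube cube_nonempty)
  show "query_points t \<subseteq> cube n"
    unfolding t learner_tree_def query_points_query_tree
    using set_Pi_pmf_uniform[OF *(3) fin(1,2)] set_Pi_pmf_uniform[OF *(4) fin(3,4)]
    by (intro learner_queries_in_cube[OF *(1,2)]) auto
  show "num_queries f t = N0 * (2 * m + 2) + N1"
    by (simp add: t learner_tree_def num_queries_query_tree length_learner_queries)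
qed

text \<open>The flip tests dominate in \<open>q\<close>, with q^4 * m^2 of order q^16, but carry no
  2 ^ k; the agreement samples carry 2 ^ k with a smaller power of \<open>q\<close>. Both are
  rounded up to the product.\<close>

lemma query_bound:
  fixes q k m :: nat
  assumes q: "1 \<le> q" "k \<le> q" and m: "m = 6912 * q ^ 6"
  shows "real (55296 * q ^ 4 * m * (2 * m + 2) + 2 * q ^ 2 * (2 * m * k + 2 ^ k + 24))
     \<le> 2 ^ k * (10 ^ 14 * real q ^ 16)"
proof -
  have m1: "1 \<le> m" using q m by (simp add: Suc_le_eq)
  have k1: "1 \<le> (2::nat) ^ k" by simp
  have "55296 * q ^ 4 * m * (2 * m + 2) \<le> 55296 * q ^ 4 * m * (4 * m)"
    using m1 by (intro mult_left_mono) auto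
  also have "\<dots> = 221184 * 6912 ^ 2 * q ^ 16"
    by (simp add: m power2_eq_square flip: power_add power_mult)
  also have "\<dots> \<le> 2 ^ k * (221184 * 6912 ^ 2 * q ^ 16)" using k1 by simp
  finally have 1: "55296 * q ^ 4 * m * (2 * m + 2) \<le> 2 ^ k * (221184 * 6912 ^ 2 * q ^ 16)" .
  have "2 * m * k \<le> 2 ^ k * (2 * m * q)"
    using mult_le_mono[OF k1 mult_le_mono2[OF q(2), of "2 * m"]] by simp
  moreover have "2 ^ k \<le> 2 ^ k * (m * q)" "24 \<le> 2 ^ k * (24 * (m * q))"
    using m1 q k1 by auto
  ultimately have "2 * m * k + 2 ^ k + 24 \<le> 2 ^ k * (2 * m * q) + 2 ^ k * (m * q) + 2 ^ k * (24 * (m * q))"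
    by linarith
  also have "\<dots> = 2 ^ k * (27 * m * q)" by (simp add: algebra_simps)
  finally have "2 * q ^ 2 * (2 * m * k + 2 ^ k + 24) \<le> 2 * q ^ 2 * (2 ^ k * (27 * m * q))"
    by (rule mult_le_mono2)
  also have "\<dots> = 2 ^ k * (54 * 6912 * q ^ 9)"
    by (simp add: m power2_eq_square flip: power_add power_Suc power_Suc2)
  also have "\<dots> \<le> 2 ^ k * (54 * 6912 * q ^ 16)"
    using q by (intro mult_le_mono2 power_increasing) auto
  finally have 2: "2 * q ^ 2 * (2 * m * k + 2 ^ k + 24) \<le> 2 ^ k * (54 * 6912 * q ^ 16)" .
  have "55296 * q ^ 4 * m * (2 * m + 2) + 2 * q ^ 2 * (2 * m * k + 2 ^ k + 24)
     \<le> 2 ^ k * (221184 * 6912 ^ 2 * q ^ 16) + 2 ^ k * (54 * 6912 * q ^ 16)"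
    using 1 2 by (rule add_mono)
  also have "\<dots> = (221184 * 6912 ^ 2 + 54 * 6912) * (2 ^ k * q ^ 16)" by (simp add: algebra_simps)
  also have "\<dots> \<le> 10 ^ 14 * (2 ^ k * q ^ 16)" by (intro mult_le_mono1) simp
  finally have "real (55296 * q ^ 4 * m * (2 * m + 2) + 2 * q ^ 2 * (2 * m * k + 2 ^ k + 24))
     \<le> real (10 ^ 14 * (2 ^ k * q ^ 16))" by (rule of_nat_mono)
  then show ?thesis by (simp add: mult_ac)
qed

theorem theorem1p3:
  "\<exists>(A :: nat \<Rightarrow> nat \<Rightarrow> real \<Rightarrow>
          (nat \<Rightarrow> real, real \<times> ((nat \<Rightarrow> real) \<Rightarrow> real)) decision_tree pmf)
     (p :: real poly poly).
     \<forall>(n::nat) (k::nat) (\<epsilon>::real). k \<le> n \<longrightarrow> 0 < \<epsilon> \<longrightarrow>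
       (\<forall>t\<in>set_pmf (A n k \<epsilon>). query_points t \<subseteq> cube n) \<and>
       (\<forall>f\<in>bool_funs n.
          (\<forall>t\<in>set_pmf (A n k \<epsilon>).
             real (num_queries f t) \<le> 2 ^ k * poly2 p (real k) (1 / \<epsilon>)) \<and>
          measure_pmf.prob (A n k \<epsilon>)
            {t. case run f t of (c, h) \<Rightarrow>
                  h \<in> bool_funs k \<and>
                  \<bar>c - max_corr n k f\<bar> \<le> \<epsilon> \<and>
                  (\<exists>i\<in>coords n k.
                     \<bar>max_corr n k f - corr n (\<lambda>x. h (proj k i x)) f\<bar> \<le> \<epsilon>)} \<ge> 2 / 3)"
proof -
  \<comment> \<open>The factor 8 * (k + 1) exceeds both 2 * k and 3 * k + 5. The factor 1 + 1 /
    \<epsilon>, rather than 1 / \<epsilon>, keeps \<open>q\<close> large enough for large \<epsilon>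
    too.\<close>
  define Q :: "nat \<Rightarrow> real \<Rightarrow> nat" where "Q k \<epsilon> = nat \<lceil>8 * (real k + 1) * (1 + 1 / \<epsilon>)\<rceil>" for k \<epsilon>
  define M where "M q = 6912 * q ^ 6" for q :: nat
  define N0 where "N0 q = 55296 * q ^ 4 * M q" for q
  define N1 where "N1 k q = 2 * q ^ 2 * (2 * M q * k + 2 ^ k + 24)" for k q
  define A where "A n k \<epsilon> = (let q = Q k \<epsilon> in learner n k q (M q) (1 / (12 * (real q)\<^sup>2)) (N0 q) (N1 k q))" for n k \<epsilon>
  \<comment> \<open>In \<open>poly2\<close> the inner variable stands for \<open>k\<close> and the
    outer one for 1 / \<epsilon>; the base of the power bounds \<open>q\<close>.\<close>
  define p :: "real poly poly" where "p = [:[:10 ^ 14:]:] * ([:[:9, 9:]:] * [:1, 1:]) ^ 16"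
  have p: "poly2 p x y = 10 ^ 14 * (9 * (x + 1) * (1 + y)) ^ 16" for x y
    by (simp add: poly2_def p_def algebra_simps)
  have "(\<forall>t\<in>set_pmf (A n k \<epsilon>). query_points t \<subseteq> cube n) \<and>
       (\<forall>f\<in>bool_funs n.
          (\<forall>t\<in>set_pmf (A n k \<epsilon>).
             real (num_queries f t) \<le> 2 ^ k * poly2 p (real k) (1 / \<epsilon>)) \<and>
          measure_pmf.prob (A n k \<epsilon>)
            {t. case run f t of (c, h) \<Rightarrow>
                  h \<in> bool_funs k \<and>
                  \<bar>c - max_corr n k f\<bar> \<le> \<epsilon> \<and>
                  (\<exists>i\<in>coords n k.
                     \<bar>max_corr n k f - corr n (\<lambda>x. h (proj k i x)) f\<bar> \<le> \<epsilon>)} \<ge> 2 / 3)"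
    if kn: "k \<le> n" and \<epsilon>: "0 < \<epsilon>" for n k \<epsilon>
  proof -
    define q where "q = Q k \<epsilon>"
    define r where "r = (real k + 1) * (1 + 1 / \<epsilon>)"
    have r1: "real k + 1 \<le> r" using \<epsilon> by (simp add: r_def algebra_simps)
    have r2: "(real k + 1) / \<epsilon> \<le> r" by (simp add: r_def algebra_simps add_divide_distrib)
    have q_eq: "q = nat \<lceil>8 * r\<rceil>" by (simp only: q_def Q_def r_def mult.assoc)
    have q_ge: "8 * r \<le> real q" unfolding q_eq by (rule real_nat_ceiling_ge)
    \<comment> \<open>Rounding up adds at most 1, which is at most \<open>r\<close>; hence 9 instead
      of 8.\<close>
    have q_le: "real q \<le> 9 * r"
      using r1 of_int_ceiling_le_add_one[of "8 * r"] unfolding q_eq by linarith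
    have "8 * (real k + 1) \<le> 8 * r" by (intro mult_left_mono r1) simp
    then have "8 * (real k + 1) \<le> real q" using q_ge by (rule order_trans)
    then have "real (8 * (k + 1)) \<le> real q" by simp
    then have "8 * (k + 1) \<le> q" by (rule of_nat_le_iff[THEN iffD1])
    then have q1: "1 \<le> q" and qk: "2 * k \<le> q" by auto
    have q\<epsilon>: "(3 * real k + 5) / q \<le> \<epsilon>"
    proof -
      have "3 * real k + 5 \<le> 8 * (real k + 1)" by simp
      also have "\<dots> = 8 * ((real k + 1) / \<epsilon>) * \<epsilon>" using \<epsilon> by simp
      also have "\<dots> \<le> real q * \<epsilon>"
      proof (rule mult_right_mono)
        have "8 * ((real k + 1) / \<epsilon>) \<le> 8 * r" by (intro mult_left_mono r2) simp
        then show "8 * ((real k + 1) / \<epsilon>) \<le> real q" using q_ge by (rule order_trans)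
      qed (use \<epsilon> in simp)
      finally show ?thesis using q1 by (simp add: divide_le_eq mult.commute)
    qed
    have M1: "1 \<le> M q" using q1 by (simp add: M_def Suc_le_eq)
    have A: "A n k \<epsilon> = learner n k q (M q) (1 / (12 * (real q)\<^sup>2)) (N0 q) (N1 k q)"
      by (simp add: A_def q_def Let_def)
    have points: "\<forall>t\<in>set_pmf (A n k \<epsilon>). query_points t \<subseteq> cube n"
      unfolding A using learner_support(1)[OF _ q1 M1] by blast
    moreover have "real (num_queries f t) \<le> 2 ^ k * poly2 p (real k) (1 / \<epsilon>)" if "t \<in> set_pmf (A n k \<epsilon>)" for f t
    proof -
      have "real (num_queries f t) = real (55296 * q ^ 4 * M q * (2 * M q + 2) + 2 * q ^ 2 * (2 * M q * k + 2 ^ k + 24))"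
        using learner_support(2)[OF that[unfolded A] q1 M1] by (simp only: N0_def N1_def)
      also have "\<dots> \<le> 2 ^ k * (10 ^ 14 * real q ^ 16)"
        using q1 qk by (intro query_bound) (auto simp: M_def)
      also have "\<dots> \<le> 2 ^ k * (10 ^ 14 * (9 * r) ^ 16)"
        using q_le by (intro mult_left_mono power_mono) auto
      finally show ?thesis by (simp only: p r_def mult.assoc)
    qed
    moreover have "2 / 3 \<le> measure_pmf.prob (A n k \<epsilon>)
            {t. case run f t of (c, h) \<Rightarrow>
                  h \<in> bool_funs k \<and>
                  \<bar>c - max_corr n k f\<bar> \<le> \<epsilon> \<and>
                  (\<exists>i\<in>coords n k.
                     \<bar>max_corr n k f - corr n (\<lambda>x. h (proj k i x)) f\<bar> \<le> \<epsilon>)}" if f: "f \<in> bool_funs n" for f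
    proof -
      interpret noisy_oracle n q f
        using q1 bool_funs_values[OF f] by unfold_locales auto
      have "measure_pmf.prob (A n k \<epsilon>) {t. \<not> success k \<epsilon> (run f t)} \<le> 1 / 3"
        unfolding A by (rule prob_learner_failure[OF kn f refl qk q\<epsilon> M_def N0_def N1_def])
      moreover have "measure_pmf.prob (A n k \<epsilon>) {t. success k \<epsilon> (run f t)}
          = 1 - measure_pmf.prob (A n k \<epsilon>) {t. \<not> success k \<epsilon> (run f t)}"
        by (subst measure_pmf.prob_compl[symmetric]) (auto intro: arg_cong[where f = "measure_pmf.prob (A n k \<epsilon>)"])
      ultimately show ?thesis by (simp add: success_def)
    qed
    ultimately show ?thesis by blast
  qed
  then show ?thesis by blast
qed

end
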